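(* Let $\mathrm S_n$ act by automorphisms on $\mathrm W_n$ by $\pi(X^j)=X^{\pi(j)}$, $\pi(D_j)=D_{\pi(j)}$ for $\pi\in\mathrm S_n$, extend this action to $\mathfrak{k}[a_1,\dots,a_n]\otimes\mathrm T^{-1}\mathrm W_n$ (trivially on the $a_i$), and transport it by the isomorphism $\mu$ to an action of $\mathrm S_n$ by automorphisms on $\mathrm S_x^{-1}\mathrm{Diff}_{\mathbf h}(n)$. Then the subring $\mathrm{Diff}_{\mathbf h}(n)$ is preserved by this action, and the transpositions $s_i=(i,i+1)$, $i=1,\dots,n-1$, act on it by $$s_i(x^i)=-x^{i+1}\tilde h_{i,i+1},\quad s_i(x^{i+1})=x^i\frac{1}{\tilde h_{i,i+1}},\quad s_i(x^j)=x^j\ \text{for } j\ne i,i+1,$$ $$s_i(\bar\partial_i)=-\frac{1}{\tilde h_{i,i+1}}\bar\partial_{i+1},\quad s_i(\bar\partial_{i+1})=\tilde h_{i,i+1}\bar\partial_i,\quad s_i(\bar\partial_j)=\bar\partial_j\ \text{for } j\ne i,i+1,$$ $$s_i(\tilde h_j)=\tilde h_{s_i(j)}.$$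
   Context: $n\ge 1$ is an integer; $\mathfrak{k}$ is a commutative integral domain of characteristic zero (the ground ring). $\mathrm{U}(\mathbf h)=\mathfrak{k}[\tilde h_1,\dots,\tilde h_n]$ is the polynomial ring; $\tilde h_{ij}:=\tilde h_i-\tilde h_j$; $\bar{\mathrm U}(\mathbf h)$ is the localization of $\mathrm{U}(\mathbf h)$ at the multiplicative set generated by all $\tilde h_{ij}+k$, $i\ne j$, $k\in\mathbb{Z}$. The ring $\mathrm{Diff}_{\mathbf h}(n)$ of $\mathbf h$-deformed differential operators of type A is the $\mathfrak k$-algebra generated by $\bar{\mathrm U}(\mathbf h)$ and elements $x^j,\bar\partial_j$, $j=1,\dots,n$, with defining relations (for all indices, besides those of $\bar{\mathrm U}(\mathbf h)$; relations for $\tilde h_i$ extend to all of $\bar{\mathrm U}(\mathbf h)$): $$\tilde h_i x^j=x^j(\tilde h_i+\delta_i^j),\qquad \tilde h_i\bar\partial_j=\bar\partial_j(\tilde h_i-\delta_i^j),$$ $$x^ix^j=\frac{\tilde h_{ij}+1}{\tilde h_{ij}}x^jx^i\ (i<j),\qquad \bar\partial_i\bar\partial_j=\frac{\tilde h_{ij}-1}{\tilde h_{ij}}\bar\partial_j\bar\partial_i\ (i<j),$$ $$x^i\bar\partial_j=\bar\partial_jx^i\ (i<j),\qquad x^i\bar\partial_j=\frac{\tilde h_{ij}(\tilde h_{ij}-2)}{(\tilde h_{ij}-1)^2}\bar\partial_jx^i\ (i>j),\qquad x^i\bar\partial_i=\sum_{j=1}^n\frac{1}{1-\tilde h_{ij}}\bar\partial_jx^j-1.$$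 It is free as a one-sided $\bar{\mathrm U}(\mathbf h)$-module and has no zero divisors. $\mathrm{S}_x^{-1}\mathrm{Diff}_{\mathbf h}(n)$ is its (Ore) localization at the multiplicative set $\mathrm S_x$ generated by $x^1,\dots,x^n$. The Weyl algebra $\mathrm W_n$ is the $\mathfrak k$-algebra with generators $X^j,D_j$, $j=1,\dots,n$, and relations $X^iX^j=X^jX^i$, $D_iD_j=D_jD_i$, $D_iX^j=\delta_i^j+X^jD_i$. $\mathrm T^{-1}\mathrm W_n$ is its (Ore) localization at the multiplicative set $\mathrm T$ generated by $X^jD_j-X^kD_k+\ell$ ($1\le j<k\le n$, $\ell\in\mathbb Z$) and $X^j$ ($1\le j\le n$). $a_1,\dots,a_n$ are commuting indeterminates. Let $\psi_i':=\prod_{k<i}\tilde h_{ik}$, $\Gamma_j:=\bar\partial_jx^j$, $e_k$ the $k$-th elementary symmetric function of $\tilde h_1,\dots,\tilde h_n$, $c_k:=\sum_j\frac{\partial e_k}{\partial\tilde h_j}\Gamma_j-e_k$, and $\mathcal H_i:=D_iX^i$. The ring isomorphism $\mu\colon\mathfrak{k}[a_1,\dots,a_n]\otimes\mathrm T^{-1}\mathrm W_n\to\mathrm S_x^{-1}\mathrm{Diff}_{\mathbf h}(n)$ is the one determined by $X^i\mapsto x^i\psi_i'$, $\mathcal H_i\mapsto\tilde h_i$, $a_i\mapsto c_i$, $i=1,\dots,n$. *)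

theory Defs
  imports
    "HOL-Library.Poly_Mapping"
    "HOL-Computational_Algebra.Fraction_Field"
    "HOL-Combinatorics.Perm"
begin

section \<open>Rings and algebras\<close>

text \<open>
  Noncommutative unital rings are types of sort \<open>{ring, monoid_mult}\<close>; compared with
  \<open>ring_1\<close> only the axiom \<open>0 \<noteq> 1\<close> is missing, so that an algebra presented by generators and
  relations is an instance without a proof that it does not collapse.
  A \<open>'k\<close>-algebra is such a ring together with its structure map \<open>\<kappa>\<close> from \<open>'k\<close>.
\<close>

definition is_ring_hom :: "('a::{ring, monoid_mult} \<Rightarrow> 'b::{ring, monoid_mult}) \<Rightarrow> bool" where
  "is_ring_hom f \<longleftrightarrow>
     (\<forall>x y. f (x + y) = f x + f y) \<and> (\<forall>x y. f (x * y) = f x * f y) \<and> f 1 = 1"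

definition is_alg_iso ::
  "('k \<Rightarrow> 'a::{ring, monoid_mult}) \<Rightarrow> ('k \<Rightarrow> 'b::{ring, monoid_mult}) \<Rightarrow> ('a \<Rightarrow> 'b) \<Rightarrow> bool" where
  "is_alg_iso \<kappa> \<kappa>' f \<longleftrightarrow> is_ring_hom f \<and> (\<forall>c. f (\<kappa> c) = \<kappa>' c) \<and> bij f"

definition is_unit_elem :: "'a::monoid_mult \<Rightarrow> bool" where
  "is_unit_elem x \<longleftrightarrow> (\<exists>y. x * y = 1 \<and> y * x = 1)"

inductive_set mult_gen :: "'a::monoid_mult set \<Rightarrow> 'a set" for S where
  one: "1 \<in> mult_gen S"
| mult: "s \<in> S \<Longrightarrow> t \<in> mult_gen S \<Longrightarrow> s * t \<in> mult_gen S"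

text \<open>
  \<open>\<theta>\<close> exhibits \<open>'q\<close> as the left Ore localization (left ring of fractions) of \<open>'a\<close> at
  the multiplicative set \<open>S\<close>: elements of \<open>S\<close> become invertible, every element has the form
  \<open>\<theta>(s)\<^sup>-\<^sup>1 \<theta>(r)\<close>, and the kernel is the left \<open>S\<close>-torsion.
\<close>

definition is_localization ::
  "'a::{ring, monoid_mult} set \<Rightarrow> ('a \<Rightarrow> 'q::{ring, monoid_mult}) \<Rightarrow> bool" where
  "is_localization S \<theta> \<longleftrightarrow>
     is_ring_hom \<theta> \<and>
     (\<forall>s\<in>S. is_unit_elem (\<theta> s)) \<and>
     (\<forall>q. \<exists>s\<in>S. \<exists>r. \<theta> s * q = \<theta> r) \<and>
     (\<forall>r. \<theta> r = 0 \<longleftrightarrow> (\<exists>s\<in>S. s * r = 0))"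

definition is_sym_action ::
  "('k \<Rightarrow> 'a::{ring, monoid_mult}) \<Rightarrow> ('n perm \<Rightarrow> 'a \<Rightarrow> 'a) \<Rightarrow> bool" where
  "is_sym_action \<kappa> \<sigma> \<longleftrightarrow>
     (\<forall>p. is_alg_iso \<kappa> \<kappa> (\<sigma> p)) \<and> \<sigma> 1 = id \<and> (\<forall>p q. \<sigma> (p * q) = \<sigma> p \<circ> \<sigma> q)"

definition transport_action :: "('a \<Rightarrow> 'b) \<Rightarrow> ('p \<Rightarrow> 'a \<Rightarrow> 'a) \<Rightarrow> 'p \<Rightarrow> 'b \<Rightarrow> 'b" where
  "transport_action \<mu> \<sigma> p = \<mu> \<circ> \<sigma> p \<circ> inv \<mu>"


section \<open>Free algebras and two-sided ideals\<close>

datatype 'g fword = Word "'g list"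

instantiation fword :: (type) monoid_add
begin

definition zero_fword :: "'a fword" where
  "0 = Word []"

fun plus_fword :: "'a fword \<Rightarrow> 'a fword \<Rightarrow> 'a fword" where
  "Word u + Word v = Word (u @ v)"

instance
proof
  fix a b c :: "'a fword"
  show "a + b + c = a + (b + c)"
    by (cases a; cases b; cases c) simp
  show "0 + a = a" "a + 0 = a"
    by (cases a; simp add: zero_fword_def)+
qed

end

text \<open>The free associative algebra is the monoid algebra of the free monoid.\<close>

type_synonym ('g, 'k) free_alg = "'g fword \<Rightarrow>\<^sub>0 'k"

definition fgen :: "'g \<Rightarrow> ('g, 'k::comm_ring_1) free_alg" where
  "fgen g = Poly_Mapping.single (Word [g]) 1"

definition fconst :: "'k \<Rightarrow> ('g, 'k::comm_ring_1) free_alg" where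
  "fconst c = Poly_Mapping.single 0 c"

inductive_set ideal_gen :: "'a::ring_1 set \<Rightarrow> 'a set" for R where
  zero: "0 \<in> ideal_gen R"
| gen: "r \<in> R \<Longrightarrow> r \<in> ideal_gen R"
| add: "x \<in> ideal_gen R \<Longrightarrow> y \<in> ideal_gen R \<Longrightarrow> x + y \<in> ideal_gen R"
| left: "x \<in> ideal_gen R \<Longrightarrow> a * x \<in> ideal_gen R"
| right: "x \<in> ideal_gen R \<Longrightarrow> x * a \<in> ideal_gen R"

definition ideal_cong :: "'a::ring_1 set \<Rightarrow> 'a \<Rightarrow> 'a \<Rightarrow> bool" where
  "ideal_cong R x y \<longleftrightarrow> x - y \<in> ideal_gen R"

lemma ideal_gen_uminus: "x \<in> ideal_gen R \<Longrightarrow> - x \<in> ideal_gen R"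
  using ideal_gen.left[of x R "-1"] by simp

lemma ideal_cong_add:
  assumes "ideal_cong R x x'" "ideal_cong R y y'"
  shows "ideal_cong R (x + y) (x' + y')"
  using ideal_gen.add[of "x - x'" R "y - y'"] assms
  by (simp add: ideal_cong_def algebra_simps)

lemma ideal_cong_uminus:
  assumes "ideal_cong R x x'"
  shows "ideal_cong R (- x) (- x')"
  using ideal_gen_uminus[of "x - x'" R] assms
  by (simp add: ideal_cong_def)

lemma ideal_cong_diff:
  assumes "ideal_cong R x x'" "ideal_cong R y y'"
  shows "ideal_cong R (x - y) (x' - y')"
  using ideal_cong_add[OF assms(1) ideal_cong_uminus[OF assms(2)]] by simp

lemma ideal_cong_mult:
  assumes "ideal_cong R x x'" "ideal_cong R y y'"
  shows "ideal_cong R (x * y) (x' * y')"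
proof -
  have "(x - x') * y + x' * (y - y') \<in> ideal_gen R"
    using assms by (auto simp: ideal_cong_def intro: ideal_gen.intros)
  then show ?thesis
    by (simp add: ideal_cong_def algebra_simps)
qed

lemma equivp_ideal_cong: "equivp (ideal_cong R)"
proof (rule equivpI)
  show "reflp (ideal_cong R)"
    by (simp add: reflp_def ideal_cong_def ideal_gen.zero)
  show "symp (ideal_cong R)"
    by (metis sympI ideal_cong_def ideal_gen_uminus minus_diff_eq)
  show "transp (ideal_cong R)"
  proof (rule transpI)
    fix x y z
    assume "ideal_cong R x y" "ideal_cong R y z"
    then show "ideal_cong R x z"
      using ideal_gen.add[of "x - y" R "y - z"] by (simp add: ideal_cong_def)
  qed
qed


section \<open>Polynomials in \<open>n\<close> variables\<close>

text \<open>
  The index set \<open>{1..n}\<close> is a nonempty finite linearly ordered type \<open>'n\<close>;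
  \<open>pos\<close> is its order isomorphism onto \<open>{1..CARD('n)}\<close>.
\<close>

definition pos :: "'n::{finite, linorder} \<Rightarrow> nat" where
  "pos i = card {..i}"

type_synonym ('r, 'n) mpoly = "('n \<Rightarrow>\<^sub>0 nat) \<Rightarrow>\<^sub>0 'r"

definition mvar :: "'n \<Rightarrow> ('r::ring_1, 'n) mpoly" where
  "mvar i = Poly_Mapping.single (Poly_Mapping.single i 1) 1"

definition mconst :: "'r \<Rightarrow> ('r::ring_1, 'n) mpoly" where
  "mconst c = Poly_Mapping.single 0 c"

definition hdiff_poly :: "'n \<Rightarrow> 'n \<Rightarrow> ('r::ring_1, 'n) mpoly" where
  "hdiff_poly i j = mvar i - mvar j"

text \<open>Formal partial derivative; the truncated exponent only occurs with coefficient \<open>0\<close>.\<close>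

definition mpderiv :: "'n \<Rightarrow> ('r::ring_1, 'n) mpoly \<Rightarrow> ('r, 'n) mpoly" where
  "mpderiv j p =
     (\<Sum>m\<in>Poly_Mapping.keys p.
        Poly_Mapping.single (m - Poly_Mapping.single j 1)
          (of_nat (Poly_Mapping.lookup m j) * Poly_Mapping.lookup p m))"

definition elem_sym :: "nat \<Rightarrow> ('r::comm_ring_1, 'n::finite) mpoly" where
  "elem_sym k = (\<Sum>S | card S = k. \<Prod>i\<in>S. mvar i)"

definition psi' :: "'n::{finite, linorder} \<Rightarrow> ('r::comm_ring_1, 'n) mpoly" where
  "psi' i = (\<Prod>k\<in>{..<i}. hdiff_poly i k)"


section \<open>The localized polynomial ring\<close>

definition hdenoms :: "('k::idom, 'n) mpoly set" where
  "hdenoms = mult_gen {hdiff_poly i j + of_int k | i j k. i \<noteq> j}"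

lemma mult_gen_closed:
  assumes "s \<in> mult_gen S" "t \<in> mult_gen S"
  shows "s * t \<in> mult_gen S"
  using assms by (induction) (auto simp: mult.assoc intro: mult_gen.intros)

lemma hdiff_poly_nonzero:
  assumes "i \<noteq> j"
  shows "hdiff_poly i j + of_int k \<noteq> (0 :: ('k::idom, 'n) mpoly)"
proof
  assume *: "hdiff_poly i j + of_int k = (0 :: ('k, 'n) mpoly)"
  have "Poly_Mapping.single i (1::nat) \<noteq> Poly_Mapping.single j 1"
    using assms by (metis lookup_single_eq lookup_single_not_eq zero_neq_one)
  moreover have "Poly_Mapping.single i (1::nat) \<noteq> 0"
    by (metis lookup_single_eq lookup_zero zero_neq_one)
  ultimately have "Poly_Mapping.lookup (hdiff_poly i j + of_int k :: ('k, 'n) mpoly)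
      (Poly_Mapping.single i 1) = 1"
    by (simp add: hdiff_poly_def mvar_def lookup_add lookup_minus lookup_single lookup_of_int when_def)
  with * show False by simp
qed

lemma hdenoms_nonzero:
  assumes "q \<in> (hdenoms :: ('k::idom, 'n::linorder) mpoly set)"
  shows "q \<noteq> 0"
  using assms unfolding hdenoms_def
  by induction (auto simp: hdiff_poly_nonzero)

lemma one_in_hdenoms [simp]: "1 \<in> hdenoms"
  by (simp add: hdenoms_def mult_gen.one)

lemma hdenoms_mult: "p \<in> hdenoms \<Longrightarrow> q \<in> hdenoms \<Longrightarrow> p * q \<in> hdenoms"
  by (simp add: hdenoms_def mult_gen_closed)

text \<open>The localization of the polynomial ring at \<open>hdenoms\<close>, inside its field of fractions.\<close>

typedef (overloaded) ('k, 'n) ubar =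
  "{Fract p q | p q. q \<in> hdenoms} :: ('k::idom, 'n::linorder) mpoly fract set"
  using one_in_hdenoms by blast

setup_lifting type_definition_ubar

instantiation ubar :: (idom, linorder) comm_ring_1
begin

lift_definition zero_ubar :: "('a, 'b) ubar" is 0
  by (metis (mono_tags, lifting) Zero_fract_def one_in_hdenoms mem_Collect_eq)

lift_definition one_ubar :: "('a, 'b) ubar" is 1
  by (metis (mono_tags, lifting) One_fract_def one_in_hdenoms mem_Collect_eq)

lift_definition plus_ubar :: "('a, 'b) ubar \<Rightarrow> ('a, 'b) ubar \<Rightarrow> ('a, 'b) ubar" is "(+)"
  using hdenoms_nonzero hdenoms_mult by (fastforce)

lift_definition uminus_ubar :: "('a, 'b) ubar \<Rightarrow> ('a, 'b) ubar" is uminus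
  by (fastforce)

lift_definition minus_ubar :: "('a, 'b) ubar \<Rightarrow> ('a, 'b) ubar \<Rightarrow> ('a, 'b) ubar" is "(-)"
  using hdenoms_nonzero hdenoms_mult by (fastforce)

lift_definition times_ubar :: "('a, 'b) ubar \<Rightarrow> ('a, 'b) ubar \<Rightarrow> ('a, 'b) ubar" is "(*)"
  using hdenoms_mult by (fastforce)

instance
  by standard (transfer; simp add: algebra_simps)+

end

text \<open>
  \<open>ufrac p q\<close> is the fraction \<open>p / q\<close>; the value for \<open>q\<close> outside the denominator set is junk.
\<close>

lift_definition ufrac :: "('k::idom, 'n::linorder) mpoly \<Rightarrow> ('k, 'n) mpoly \<Rightarrow> ('k, 'n) ubar"
  is "\<lambda>p q. Fract p (if q \<in> hdenoms then q else 1)"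
  by (metis (mono_tags, lifting) mem_Collect_eq one_in_hdenoms)

abbreviation upoly :: "('k::idom, 'n::linorder) mpoly \<Rightarrow> ('k, 'n) ubar" where
  "upoly p \<equiv> ufrac p 1"

lemma ufrac_mult_upoly: "q \<in> hdenoms \<Longrightarrow> ufrac p q * upoly q = upoly p"
  by transfer (simp add: eq_fract hdenoms_nonzero)

lemma hdiff_poly_in_hdenoms:
  "i \<noteq> j \<Longrightarrow> hdiff_poly i j + of_int k \<in> hdenoms"
  unfolding hdenoms_def by (metis (mono_tags, lifting) mem_Collect_eq mult.right_neutral mult_gen.simps)

lemma relation_denominators:
  fixes i j :: "'n::linorder"
  defines "hij \<equiv> (hdiff_poly i j :: ('k::idom, 'n) mpoly)"
  shows "i \<noteq> j \<Longrightarrow> hij \<in> hdenoms"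
    and "i \<noteq> j \<Longrightarrow> (hij - 1)\<^sup>2 \<in> hdenoms"
    and "1 - hij \<in> hdenoms"
proof -
  show "hij \<in> hdenoms" if "i \<noteq> j"
    using hdiff_poly_in_hdenoms[OF that, of 0, where ?'b = 'k] by (simp add: hij_def)
  show "(hij - 1)\<^sup>2 \<in> hdenoms" if "i \<noteq> j"
  proof -
    have "hij - 1 \<in> hdenoms"
      using hdiff_poly_in_hdenoms[OF that, of "-1", where ?'b = 'k] by (simp add: hij_def)
    then show ?thesis
      unfolding power2_eq_square by (intro hdenoms_mult)
  qed
  show "1 - hij \<in> hdenoms"
  proof (cases "i = j")
    case True
    then show ?thesis by (simp add: hij_def hdiff_poly_def)
  next
    case False
    then show ?thesis
      using hdiff_poly_in_hdenoms[of j i 1, where ?'b = 'k]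
      by (simp add: hij_def hdiff_poly_def algebra_simps)
  qed
qed


section \<open>The ring of \<open>h\<close>-deformed differential operators\<close>

text \<open>
  Generators: one symbol \<open>HU u\<close> for each element \<open>u\<close> of the localized polynomial ring, and
  \<open>HX j\<close>, \<open>HD j\<close>. The first three families of relations say that \<open>HU\<close> is a homomorphism
  of \<open>'k\<close>-algebras.
\<close>

datatype ('u, 'n) hdiff_gen = HU 'u | HX 'n | HD 'n

definition hdiff_rels ::
  "((('k::idom, 'n::{finite, linorder}) ubar, 'n) hdiff_gen, 'k) free_alg set" where
  "hdiff_rels = (let
      U = (\<lambda>u. fgen (HU u)); x = (\<lambda>j. fgen (HX j)); d = (\<lambda>j. fgen (HD j));
      h = (\<lambda>i. mvar i); hh = (\<lambda>i j. hdiff_poly i j); \<delta> = (\<lambda>i j. if i = j then 1 else 0)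
    in
      {U (u + v) - (U u + U v) | u v. True}
    \<union> {U (u * v) - U u * U v | u v. True}
    \<union> {U (upoly (mconst c)) - fconst c | c. True}
    \<union> {U (upoly (h i)) * x j - x j * U (upoly (h i + \<delta> i j)) | i j. True}
    \<union> {U (upoly (h i)) * d j - d j * U (upoly (h i - \<delta> i j)) | i j. True}
    \<union> {x i * x j - U (ufrac (hh i j + 1) (hh i j)) * x j * x i | i j. i < j}
    \<union> {d i * d j - U (ufrac (hh i j - 1) (hh i j)) * d j * d i | i j. i < j}
    \<union> {x i * d j - d j * x i | i j. i < j}
    \<union> {x i * d j - U (ufrac (hh i j * (hh i j - 2)) ((hh i j - 1)\<^sup>2)) * d j * x i | i j. i > j}
    \<union> {x i * d i - ((\<Sum>j\<in>UNIV. U (ufrac 1 (1 - hh i j)) * d j * x j) - 1) | i. True})"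

quotient_type (overloaded) ('k, 'n) hdiff =
  "((('k::idom, 'n::{finite, linorder}) ubar, 'n) hdiff_gen, 'k) free_alg" / "ideal_cong hdiff_rels"
  by (rule equivp_ideal_cong)

instantiation hdiff :: (idom, "{finite, linorder}") "{ring, monoid_mult}"
begin

lift_definition zero_hdiff :: "('a, 'b) hdiff" is 0 .
lift_definition one_hdiff :: "('a, 'b) hdiff" is 1 .
lift_definition plus_hdiff :: "('a, 'b) hdiff \<Rightarrow> ('a, 'b) hdiff \<Rightarrow> ('a, 'b) hdiff" is "(+)"
  by (rule ideal_cong_add)
lift_definition uminus_hdiff :: "('a, 'b) hdiff \<Rightarrow> ('a, 'b) hdiff" is uminus
  by (rule ideal_cong_uminus)
lift_definition minus_hdiff :: "('a, 'b) hdiff \<Rightarrow> ('a, 'b) hdiff \<Rightarrow> ('a, 'b) hdiff" is "(-)"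
  by (rule ideal_cong_diff)
lift_definition times_hdiff :: "('a, 'b) hdiff \<Rightarrow> ('a, 'b) hdiff \<Rightarrow> ('a, 'b) hdiff" is "(*)"
  by (rule ideal_cong_mult)

instance
  by standard (transfer, simp add: algebra_simps ideal_cong_def ideal_gen.zero)+

end

lift_definition hd_const :: "'k \<Rightarrow> ('k::idom, 'n::{finite, linorder}) hdiff" is fconst .
definition hd_U :: "('k, 'n) ubar \<Rightarrow> ('k::idom, 'n::{finite, linorder}) hdiff" where
  "hd_U u = abs_hdiff (fgen (HU u))"
lift_definition hd_x :: "'n \<Rightarrow> ('k::idom, 'n::{finite, linorder}) hdiff" is "\<lambda>j. fgen (HX j)" .
lift_definition hd_d :: "'n \<Rightarrow> ('k::idom, 'n::{finite, linorder}) hdiff" is "\<lambda>j. fgen (HD j)" .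

abbreviation hd_h :: "'n \<Rightarrow> ('k::idom, 'n::{finite, linorder}) hdiff" where
  "hd_h i \<equiv> hd_U (upoly (mvar i))"

abbreviation hd_hh :: "'n \<Rightarrow> 'n \<Rightarrow> ('k::idom, 'n::{finite, linorder}) hdiff" where
  "hd_hh i j \<equiv> hd_U (upoly (hdiff_poly i j))"

abbreviation hd_inv_hh :: "'n \<Rightarrow> 'n \<Rightarrow> ('k::idom, 'n::{finite, linorder}) hdiff" where
  "hd_inv_hh i j \<equiv> hd_U (ufrac 1 (hdiff_poly i j))"

definition hd_Gamma :: "'n \<Rightarrow> ('k::idom, 'n::{finite, linorder}) hdiff" where
  "hd_Gamma j = hd_d j * hd_x j"

definition hd_c :: "nat \<Rightarrow> ('k::idom, 'n::{finite, linorder}) hdiff" where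
  "hd_c k = (\<Sum>j\<in>UNIV. hd_U (upoly (mpderiv j (elem_sym k))) * hd_Gamma j)
             - hd_U (upoly (elem_sym k))"

definition S_x :: "('k::idom, 'n::{finite, linorder}) hdiff set" where
  "S_x = mult_gen (range hd_x)"


section \<open>The Weyl algebra\<close>

datatype 'n weyl_gen = WX 'n | WD 'n

definition weyl_rels :: "('n weyl_gen, 'k::comm_ring_1) free_alg set" where
  "weyl_rels = (let X = (\<lambda>j. fgen (WX j)); D = (\<lambda>j. fgen (WD j)) in
      {X i * X j - X j * X i | i j. True}
    \<union> {D i * D j - D j * D i | i j. True}
    \<union> {D i * X j - ((if i = j then 1 else 0) + X j * D i) | i j. True})"

quotient_type (overloaded) ('k, 'n) weyl =
  "('n weyl_gen, 'k::comm_ring_1) free_alg" / "ideal_cong weyl_rels"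
  by (rule equivp_ideal_cong)

instantiation weyl :: (comm_ring_1, type) "{ring, monoid_mult}"
begin

lift_definition zero_weyl :: "('a, 'b) weyl" is 0 .
lift_definition one_weyl :: "('a, 'b) weyl" is 1 .
lift_definition plus_weyl :: "('a, 'b) weyl \<Rightarrow> ('a, 'b) weyl \<Rightarrow> ('a, 'b) weyl" is "(+)"
  by (rule ideal_cong_add)
lift_definition uminus_weyl :: "('a, 'b) weyl \<Rightarrow> ('a, 'b) weyl" is uminus
  by (rule ideal_cong_uminus)
lift_definition minus_weyl :: "('a, 'b) weyl \<Rightarrow> ('a, 'b) weyl \<Rightarrow> ('a, 'b) weyl" is "(-)"
  by (rule ideal_cong_diff)
lift_definition times_weyl :: "('a, 'b) weyl \<Rightarrow> ('a, 'b) weyl \<Rightarrow> ('a, 'b) weyl" is "(*)"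
  by (rule ideal_cong_mult)

instance
  by standard (transfer, simp add: algebra_simps ideal_cong_def ideal_gen.zero)+

end

lift_definition w_const :: "'k \<Rightarrow> ('k::comm_ring_1, 'n) weyl" is fconst .
lift_definition w_X :: "'n \<Rightarrow> ('k::comm_ring_1, 'n) weyl" is "\<lambda>j. fgen (WX j)" .
lift_definition w_D :: "'n \<Rightarrow> ('k::comm_ring_1, 'n) weyl" is "\<lambda>j. fgen (WD j)" .

definition w_H :: "'n \<Rightarrow> ('k::comm_ring_1, 'n) weyl" where
  "w_H i = w_D i * w_X i"

definition T_W :: "('k::comm_ring_1, 'n::linorder) weyl set" where
  "T_W = mult_gen ({w_X j * w_D j - w_X k * w_D k + w_const (of_int l) | j k l. j < k}
                   \<union> range w_X)"


section \<open>Extension of the symmetric group action\<close>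

text \<open>
  For a localization \<open>\<theta>\<close> of the Weyl algebra with values in \<open>'b\<close>, the tensor product of
  \<open>k[a\<^sub>1, \<dots>, a\<^sub>n]\<close> (the monoid algebra of the exponents over \<open>k\<close>) with \<open>'b\<close> is the monoid algebra
  \<open>('b, 'n) mpoly\<close> of the exponents over \<open>'b\<close>: the \<open>a\<^sub>i\<close> are the \<open>mvar i\<close>, which are central,
  \<open>'b\<close> embeds by \<open>mconst\<close>, and \<open>'k\<close> acts through \<open>'b\<close>.
\<close>

definition is_weyl_action :: "('n perm \<Rightarrow> ('k::comm_ring_1, 'n) weyl \<Rightarrow> ('k, 'n) weyl) \<Rightarrow> bool" where
  "is_weyl_action \<rho> \<longleftrightarrow>
     is_sym_action w_const \<rho> \<and>
     (\<forall>p j. \<rho> p (w_X j) = w_X (Perm.apply p j)) \<and>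
     (\<forall>p j. \<rho> p (w_D j) = w_D (Perm.apply p j))"

definition is_extended_action ::
  "(('k::comm_ring_1, 'n) weyl \<Rightarrow> 'b::ring_1) \<Rightarrow> ('n perm \<Rightarrow> ('k, 'n) weyl \<Rightarrow> ('k, 'n) weyl) \<Rightarrow>
   ('n perm \<Rightarrow> ('b, 'n) mpoly \<Rightarrow> ('b, 'n) mpoly) \<Rightarrow> bool" where
  "is_extended_action \<theta> \<rho> \<sigma> \<longleftrightarrow>
     is_sym_action (\<lambda>c. mconst (\<theta> (w_const c))) \<sigma> \<and>
     (\<forall>p w. \<sigma> p (mconst (\<theta> w)) = mconst (\<theta> (\<rho> p w))) \<and>
     (\<forall>p i. \<sigma> p (mvar i) = mvar i)"

end

theory Submission
  imports Defs "HOL-Library.Cardinality"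
begin

text \<open>
  Every automorphism \<open>\<tau>\<close> in the transported action is pinned down by three facts, which are just the
  images under \<open>\<mu>\<close> of how a permutation \<open>p\<close> acts on \<open>\<H>\<^sub>j\<close>, \<open>X\<^sup>j\<close> and \<open>a\<^sub>k\<close>:
  \<open>\<tau>(h\<^sub>j) = h\<^bsub>p(j)\<^esub>\<close>, \<open>\<tau>(x\<^sup>j \<psi>'\<^sub>j) = x\<^bsup>p(j)\<^esup> \<psi>'\<^bsub>p(j)\<^esub>\<close> and \<open>\<tau>(c\<^sub>k) = c\<^sub>k\<close>.
  The first shows that \<open>\<tau>\<close> permutes the variables of the localized polynomial ring, in which the
  \<open>\<psi>'\<^sub>j\<close> are invertible, so the second gives \<open>\<tau>(x\<^sup>j)\<close>.

  The elements \<open>\<partial>\<^sub>j\<close> are not visible on the Weyl side and are recovered from the \<open>c\<^sub>k\<close>. These are an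
  affine linear transform of the \<open>\<Gamma>\<^sub>j = \<partial>\<^sub>j x\<^sup>j\<close>, with the Jacobian matrix of the elementary symmetric
  polynomials as its matrix. That matrix is diagonalized, up to invertible entries
  \<open>\<Prod>\<^bsub>l \<noteq> i\<^esub> (h\<^sub>i - h\<^sub>l)\<close>, by a matrix of signed powers of the \<open>h\<^sub>i\<close>
  (\<open>elem_sym_gradient_combination\<close>), hence invariance of the \<open>c\<^sub>k\<close> forces
  \<open>\<tau>(\<Gamma>\<^sub>j) = \<Gamma>\<^bsub>p(j)\<^esub>\<close> (\<open>Gamma\<close>). Since \<open>\<tau>(\<Gamma>\<^sub>j) = \<tau>(\<partial>\<^sub>j) \<tau>(x\<^sup>j)\<close> and \<open>x\<^sup>j\<close> is invertible in the localization,
  this determines \<open>\<tau>(\<partial>\<^sub>j)\<close> (\<open>dI\<close>). Since \<open>x\<^sup>j\<close> and \<open>\<partial>\<^sub>j\<close> commute with functions of the \<open>h\<^sub>i\<close> up to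
  integer shifts, these quotients stay in the image of the ring (\<open>preserves_range\<close>), for every
  permutation at once, and for an adjacent transposition the products \<open>\<psi>'\<^sub>i\<close> differ by a single
  factor, which produces the stated formulas.

  Existence and uniqueness of the actions are universal properties: of the presentation of the Weyl
  algebra, of the Ore localization (\<open>localization_hom_exists\<close>; a permutation maps the
  denominators to denominators up to sign), and of polynomials over a noncommutative ring.
\<close>


section \<open>Homomorphisms, units and generation\<close>

lemma is_ring_homI:
  assumes "\<And>x y. f (x + y) = f x + f y" "\<And>x y. f (x * y) = f x * f y" "f 1 = 1"
  shows "is_ring_hom f"
  using assms by (simp add: is_ring_hom_def)

lemma ring_hom_add: "is_ring_hom f \<Longrightarrow> f (x + y) = f x + f y"
  and ring_hom_mult: "is_ring_hom f \<Longrightarrow> f (x * y) = f x * f y"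
  and ring_hom_one: "is_ring_hom f \<Longrightarrow> f 1 = 1"
  by (simp_all add: is_ring_hom_def)

lemma ring_hom_zero:
  assumes "is_ring_hom f"
  shows "f 0 = 0"
  using ring_hom_add[OF assms, of 0 0] by simp

lemma ring_hom_uminus:
  assumes "is_ring_hom f"
  shows "f (- x) = - f x"
  using ring_hom_add[OF assms, of x "- x"] ring_hom_zero[OF assms]
  by (simp add: eq_neg_iff_add_eq_0 add.commute)

lemma ring_hom_diff:
  assumes "is_ring_hom f"
  shows "f (x - y) = f x - f y"
  using ring_hom_add[OF assms, of x "- y"] ring_hom_uminus[OF assms, of y] by simp

lemma ring_hom_sum:
  assumes "is_ring_hom f"
  shows "f (sum g A) = (\<Sum>a\<in>A. f (g a))"
  by (induction A rule: infinite_finite_induct)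
    (simp_all add: ring_hom_zero[OF assms] ring_hom_add[OF assms])

lemmas ring_hom_simps =
  ring_hom_add ring_hom_mult ring_hom_one ring_hom_zero ring_hom_uminus ring_hom_diff ring_hom_sum

lemma ring_hom_comp: "is_ring_hom f \<Longrightarrow> is_ring_hom g \<Longrightarrow> is_ring_hom (\<lambda>x. f (g x))"
  by (simp add: is_ring_hom_def)

lemma ring_hom_inv:
  assumes f: "is_ring_hom f" and "bij f"
  shows "is_ring_hom (inv f)"
proof -
  have *: "f (inv f y) = y" for y
    using \<open>bij f\<close> by (simp add: bij_is_surj surj_f_inv_f)
  have **: "inv f (f x) = x" for x
    using \<open>bij f\<close> by (simp add: bij_is_inj)
  have "inv f (x + y) = inv f (f (inv f x + inv f y))"
       "inv f (x * y) = inv f (f (inv f x * inv f y))" for x y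
    using f by (simp_all add: ring_hom_simps *)
  moreover have "inv f 1 = 1"
    using ** [of 1] f by (simp add: ring_hom_one)
  ultimately show ?thesis
    by (intro is_ring_homI) (simp_all add: **)
qed

lemma ring_hom_unit:
  assumes "is_ring_hom f" "is_unit_elem x"
  shows "is_unit_elem (f x)"
  using assms unfolding is_unit_elem_def by (metis ring_hom_mult ring_hom_one)

lemma unit_one: "is_unit_elem 1"
  unfolding is_unit_elem_def by (metis mult_1_left)

lemma unit_mult:
  assumes "is_unit_elem x" "is_unit_elem y"
  shows "is_unit_elem (x * y)"
proof -
  obtain a b where "x * a = 1" "a * x = 1" "y * b = 1" "b * y = 1"
    using assms by (auto simp: is_unit_elem_def)
  then have "x * y * (b * a) = 1" "b * a * (x * y) = 1"
    by (metis mult.assoc mult_1_left)+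
  then show ?thesis
    by (auto simp: is_unit_elem_def)
qed

lemma unit_uminus:
  fixes x :: "'a::{ring, monoid_mult}"
  assumes "is_unit_elem x"
  shows "is_unit_elem (- x)"
  using assms unfolding is_unit_elem_def by (metis minus_mult_minus)

lemma unit_cancel_left:
  assumes "is_unit_elem u" "u * x = u * y"
  shows "x = y"
  using assms unfolding is_unit_elem_def by (metis mult.assoc mult_1_left)

lemma unit_cancel_right:
  assumes "is_unit_elem u" "x * u = y * u"
  shows "x = y"
  using assms unfolding is_unit_elem_def by (metis mult.assoc mult_1_right)

lemma unit_mult_gen:
  assumes f: "is_ring_hom f" and S: "\<And>s. s \<in> S \<Longrightarrow> is_unit_elem (f s)" and "t \<in> mult_gen S"
  shows "is_unit_elem (f t)"
  using \<open>t \<in> mult_gen S\<close>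
  by induction (simp_all add: ring_hom_simps[OF f] unit_one unit_mult S)

lemma mult_gen_base: "s \<in> S \<Longrightarrow> s \<in> mult_gen S"
  using mult_gen.mult[OF _ mult_gen.one, of s S] by simp


lemma mult_cancel_inverse:
  fixes z :: "'a::monoid_mult"
  assumes "a * (b * z) = c" "z * s = 1"
  shows "a * b = c * s"
  using assms by (metis mult.assoc mult_1_right)


section \<open>Monoid algebras and presented algebras\<close>

text \<open>
  Linear extension of \<open>\<phi> c * \<gamma> m\<close>: the map out of a monoid algebra given by its universal
  property. One construction serves for free algebras and for polynomials.
\<close>

definition monoid_alg_eval ::
  "('c::ring_1 \<Rightarrow> 'a::{ring, monoid_mult}) \<Rightarrow> ('m \<Rightarrow> 'a) \<Rightarrow> ('m \<Rightarrow>\<^sub>0 'c) \<Rightarrow> 'a" where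
  "monoid_alg_eval \<phi> \<gamma> p =
     (\<Sum>m\<in>Poly_Mapping.keys p. \<phi> (Poly_Mapping.lookup p m) * \<gamma> m)"

lemma monoid_alg_eval_superset:
  assumes \<phi>: "is_ring_hom \<phi>" and "finite A" "Poly_Mapping.keys p \<subseteq> A"
  shows "monoid_alg_eval \<phi> \<gamma> p = (\<Sum>m\<in>A. \<phi> (Poly_Mapping.lookup p m) * \<gamma> m)"
  unfolding monoid_alg_eval_def
  by (rule sum.mono_neutral_left)
    (use assms in \<open>auto simp: ring_hom_zero[OF \<phi>] in_keys_iff\<close>)

lemma monoid_alg_eval_single:
  assumes \<phi>: "is_ring_hom \<phi>"
  shows "monoid_alg_eval \<phi> \<gamma> (Poly_Mapping.single m c) = \<phi> c * \<gamma> m"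
  by (subst monoid_alg_eval_superset[OF \<phi>, of "{m}"]) auto

lemma monoid_alg_eval_add:
  assumes \<phi>: "is_ring_hom \<phi>"
  shows "monoid_alg_eval \<phi> \<gamma> (p + q) = monoid_alg_eval \<phi> \<gamma> p + monoid_alg_eval \<phi> \<gamma> q"
proof -
  let ?A = "Poly_Mapping.keys p \<union> Poly_Mapping.keys q"
  have "monoid_alg_eval \<phi> \<gamma> r = (\<Sum>m\<in>?A. \<phi> (Poly_Mapping.lookup r m) * \<gamma> m)"
    if "Poly_Mapping.keys r \<subseteq> ?A" for r
    by (rule monoid_alg_eval_superset[OF \<phi> _ that]) simp
  then show ?thesis
    using keys_add[of p q]
    by (simp add: lookup_add ring_hom_add[OF \<phi>] distrib_right sum.distrib)
qed

lemma poly_mapping_sum_singles: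
  "p = (\<Sum>m\<in>Poly_Mapping.keys p. Poly_Mapping.single m (Poly_Mapping.lookup p m))"
  by (rule poly_mapping_eqI)
    (auto simp: lookup_sum lookup_single when_def not_in_keys_iff_lookup_eq_zero)

lemma poly_mapping_single_induct [case_names zero add]:
  fixes P :: "('m \<Rightarrow>\<^sub>0 'c::comm_monoid_add) \<Rightarrow> bool"
  assumes "P 0" "\<And>m c p. P p \<Longrightarrow> P (Poly_Mapping.single m c + p)"
  shows "P p"
proof -
  have "P (\<Sum>m\<in>A. Poly_Mapping.single m (Poly_Mapping.lookup p m))" for A
    by (induction A rule: infinite_finite_induct) (simp_all add: assms)
  then show ?thesis
    by (subst poly_mapping_sum_singles)
qed

lemma monoid_alg_eval_hom:
  fixes \<gamma> :: "'m::monoid_add \<Rightarrow> 'a::{ring, monoid_mult}"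
  assumes \<phi>: "is_ring_hom \<phi>"
    and \<gamma>: "\<gamma> 0 = 1" "\<And>m n. \<gamma> (m + n) = \<gamma> m * \<gamma> n"
    and comm: "\<And>c m. \<gamma> m * \<phi> c = \<phi> c * \<gamma> m"
  shows "is_ring_hom (monoid_alg_eval \<phi> \<gamma>)"
proof (rule is_ring_homI)
  let ?E = "monoid_alg_eval \<phi> \<gamma>"
  note simps = monoid_alg_eval_add[OF \<phi>] monoid_alg_eval_single[OF \<phi>]
  have zero: "?E 0 = 0"
    by (simp add: monoid_alg_eval_def)
  show "?E (p + q) = ?E p + ?E q" for p q
    by (rule monoid_alg_eval_add[OF \<phi>])
  show "?E 1 = 1"
    by (simp add: monoid_alg_eval_single[OF \<phi>] \<gamma> ring_hom_one[OF \<phi>] flip: single_one)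
  have single: "?E (Poly_Mapping.single m c * q) = ?E (Poly_Mapping.single m c) * ?E q" for m c q
  proof (induction q rule: poly_mapping_single_induct)
    case (add n d q)
    have "\<phi> (c * d) * \<gamma> (m + n) = \<phi> c * \<gamma> m * (\<phi> d * \<gamma> n)"
      by (metis \<gamma>(2) comm mult.assoc ring_hom_mult[OF \<phi>])
    with add show ?case
      by (simp add: distrib_left mult_single simps)
  qed (simp add: zero)
  show "?E (p * q) = ?E p * ?E q" for p q
    by (induction p rule: poly_mapping_single_induct)
      (simp_all add: zero distrib_right monoid_alg_eval_add[OF \<phi>] single)
qed

lemma ring_homs_eq_on_singles:
  assumes "is_ring_hom f" "is_ring_hom g"
    and "\<And>m c. f (Poly_Mapping.single m c) = g (Poly_Mapping.single m c)"
  shows "f p = g p"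
  by (induction p rule: poly_mapping_single_induct)
    (simp_all add: ring_hom_simps[OF assms(1)] ring_hom_simps[OF assms(2)] assms(3))

lemma ring_hom_fconst: "is_ring_hom fconst"
  by (rule is_ring_homI) (simp_all add: fconst_def single_add mult_single)

lemma fconst_central: "fconst c * p = p * fconst c"
  by (induction p rule: poly_mapping_single_induct)
    (simp_all add: fconst_def distrib_left distrib_right mult_single mult.commute)

lemma single_Cons_word:
  "Poly_Mapping.single (Word (g # l)) c = fgen g * Poly_Mapping.single (Word l) c"
  by (simp add: fgen_def mult_single)

lemma single_Nil_word: "Poly_Mapping.single (Word []) c = fconst c"
  by (simp add: fconst_def zero_fword_def)

lemma free_alg_induct [case_names const gen add mult]:
  assumes const: "\<And>c. P (fconst c)" and gen: "\<And>g. P (fgen g)"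
    and add: "\<And>p q. P p \<Longrightarrow> P q \<Longrightarrow> P (p + q)" and mult: "\<And>p q. P p \<Longrightarrow> P q \<Longrightarrow> P (p * q)"
  shows "P p"
proof (induction p rule: poly_mapping_single_induct)
  case zero
  show ?case
    using const[of 0] by (simp add: fconst_def)
next
  case (add w c p)
  have "P (Poly_Mapping.single (Word l) c)" for l
    by (induction l) (simp_all add: const gen mult single_Cons_word single_Nil_word)
  then show ?case
    using add assms(3) by (cases w) simp
qed

fun word_eval :: "('g \<Rightarrow> 'a::monoid_mult) \<Rightarrow> 'g fword \<Rightarrow> 'a" where
  "word_eval v (Word l) = prod_list (map v l)"

lemma free_alg_hom_exists:
  fixes \<kappa> :: "'k::comm_ring_1 \<Rightarrow> 'a::{ring, monoid_mult}"
  assumes \<kappa>: "is_ring_hom \<kappa>" and central: "\<And>c a. a * \<kappa> c = \<kappa> c * a"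
  obtains F where "is_ring_hom F" "\<And>c. F (fconst c) = \<kappa> c" "\<And>g. F (fgen g) = v g"
proof
  let ?F = "monoid_alg_eval \<kappa> (word_eval v)"
  have mult: "word_eval v (m + n) = word_eval v m * word_eval v n" for m n
    by (cases m; cases n) simp
  have zero: "word_eval v 0 = 1"
    by (simp add: zero_fword_def)
  show "is_ring_hom ?F"
    by (rule monoid_alg_eval_hom[OF \<kappa> zero mult central])
  show "?F (fconst c) = \<kappa> c" for c
    by (simp add: fconst_def monoid_alg_eval_single[OF \<kappa>] zero)
  show "?F (fgen g) = v g" for g
    by (simp add: fgen_def monoid_alg_eval_single[OF \<kappa>] ring_hom_one[OF \<kappa>])
qed

lemma ring_hom_ideal_gen:
  assumes F: "is_ring_hom F" and R: "\<And>r. r \<in> R \<Longrightarrow> F r = 0" and "x \<in> ideal_gen R"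
  shows "F x = 0"
  using \<open>x \<in> ideal_gen R\<close>
  by induction (simp_all add: R ring_hom_simps[OF F])


section \<open>The universal property of Ore localizations\<close>

text \<open>Homomorphisms preserve units, so equality on denominators and numerators is enough.\<close>

lemma localization_homs_eq:
  assumes loc: "is_localization S \<theta>"
    and f: "is_ring_hom f" and g: "is_ring_hom g"
    and eq: "\<And>r. f (\<theta> r) = g (\<theta> r)"
  shows "f q = g q"
proof -
  obtain s r where s: "s \<in> S" and q: "\<theta> s * q = \<theta> r"
    using loc by (meson is_localization_def)
  have "f (\<theta> s) * f q = f (\<theta> s) * g q"
    by (metis q eq ring_hom_mult[OF f] ring_hom_mult[OF g])
  moreover have "is_unit_elem (f (\<theta> s))"
    using loc s by (simp add: is_localization_def ring_hom_unit[OF f])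
  ultimately show ?thesis
    by (rule unit_cancel_left[rotated])
qed

text \<open>
  The extension is defined by \<open>\<theta>(s)\<^sup>-\<^sup>1 \<theta>(r) \<mapsto> f(s)\<^sup>-\<^sup>1 f(r)\<close>. The left Ore condition, which makes
  this independent of the fraction, is part of \<^const>\<open>is_localization\<close>: it says that
  \<open>\<theta>(s') \<theta>(s)\<^sup>-\<^sup>1\<close> is again a left fraction.
\<close>

lemma localization_hom_exists:
  fixes \<theta> :: "'a::{ring, monoid_mult} \<Rightarrow> 'q::{ring, monoid_mult}" and f :: "'a \<Rightarrow> 'r::{ring, monoid_mult}"
  assumes loc: "is_localization S \<theta>"
    and closed: "1 \<in> S" "\<And>s t. s \<in> S \<Longrightarrow> t \<in> S \<Longrightarrow> s * t \<in> S"
    and f: "is_ring_hom f" and unit: "\<And>s. s \<in> S \<Longrightarrow> is_unit_elem (f s)"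
  obtains g where "is_ring_hom g" "\<And>r. g (\<theta> r) = f r"
proof -
  have \<theta>: "is_ring_hom \<theta>" and \<theta>_unit: "\<And>s. s \<in> S \<Longrightarrow> is_unit_elem (\<theta> s)"
    and frac: "\<And>q. \<exists>s\<in>S. \<exists>r. \<theta> s * q = \<theta> r"
    and ker: "\<And>r. \<theta> r = 0 \<Longrightarrow> \<exists>s\<in>S. s * r = 0"
    using loc by (auto simp: is_localization_def)
  have equalizer: "\<exists>t\<in>S. t * r = t * r'" if "\<theta> r = \<theta> r'" for r r'
    using ker[of "r - r'"] that by (auto simp: ring_hom_diff[OF \<theta>] right_diff_distrib)
  \<comment> \<open>A value that is right for one fraction representing \<open>q\<close> is right for all of them.\<close>
  have key: "f s' * y = f r'"
    if s: "s \<in> S" "s' \<in> S" and q: "\<theta> s * q = \<theta> r" "\<theta> s' * q = \<theta> r'" and y: "f s * y = f r"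
    for s s' q r r' y
  proof -
    obtain z where z: "z * \<theta> s = 1"
      using \<theta>_unit[OF s(1)] by (auto simp: is_unit_elem_def)
    obtain t c where t: "t \<in> S" "\<theta> t * (\<theta> s' * z) = \<theta> c"
      using frac by blast
    have "\<theta> (t * s') = \<theta> (c * s)"
      using mult_cancel_inverse[OF t(2) z] by (simp add: ring_hom_mult[OF \<theta>])
    then obtain t' where t': "t' \<in> S" "t' * (t * s') = t' * (c * s)"
      using equalizer by blast
    define a b where "a = t' * t" and "b = t' * c"
    have a: "a \<in> S" and ab: "a * s' = b * s"
      using t t' by (auto simp: a_def b_def closed mult.assoc)
    have "\<theta> (a * r') = \<theta> (a * s') * q"
      by (simp add: ring_hom_mult[OF \<theta>] mult.assoc q)
    also have "\<dots> = \<theta> (b * r)"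
      by (simp add: ab ring_hom_mult[OF \<theta>] mult.assoc q)
    finally obtain t'' where t'': "t'' \<in> S" "t'' * (a * r') = t'' * (b * r)"
      using equalizer by blast
    have "f (t'' * a) * (f s' * y) = f t'' * (f (a * s') * y)"
      by (simp add: ring_hom_mult[OF f] mult.assoc)
    also have "\<dots> = f (t'' * b) * (f s * y)"
      by (simp add: ab ring_hom_mult[OF f] mult.assoc)
    also have "\<dots> = f (t'' * (b * r))"
      by (simp add: y ring_hom_mult[OF f] mult.assoc)
    also have "\<dots> = f (t'' * a) * f r'"
      by (simp add: ring_hom_mult[OF f] mult.assoc flip: t''(2))
    finally show ?thesis
      using unit_cancel_left[OF unit] closed a t'' by blast
  qed
  define G where "G q y \<longleftrightarrow> (\<exists>s\<in>S. \<exists>r. \<theta> s * q = \<theta> r \<and> f s * y = f r)" for q y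
  have G_ex: "\<exists>y. G q y" for q
  proof -
    obtain s r where sr: "s \<in> S" "\<theta> s * q = \<theta> r"
      using frac by blast
    obtain w where "f s * w = 1"
      using unit[OF sr(1)] by (auto simp: is_unit_elem_def)
    then have "f s * (w * f r) = f r"
      by (metis mult.assoc mult_1_left)
    with sr show ?thesis
      unfolding G_def by blast
  qed
  have G_frac: "f s * y = f r" if "G q y" "s \<in> S" "\<theta> s * q = \<theta> r" for q y s r
    using that key unfolding G_def by blast
  have G_unique: "y = y'" if "G q y" "G q y'" for q y y'
    using that G_frac unfolding G_def by (metis unit unit_cancel_left)
  define g where "g q = (THE y. G q y)" for q
  have g: "G q (g q)" for q
    unfolding g_def by (rule theI') (use G_ex G_unique in blast)
  have g_eq: "g q = y" if "G q y" for q y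
    using g G_unique that by blast
  have g_\<theta>: "g (\<theta> r) = f r" for r
    by (rule g_eq)
      (auto simp: G_def ring_hom_one[OF \<theta>] ring_hom_one[OF f] intro!: bexI[of _ 1] exI[of _ r] closed)
  show thesis
  proof
    show "g (\<theta> r) = f r" for r
      by (rule g_\<theta>)
    show "is_ring_hom g"
    proof (rule is_ring_homI)
      show "g 1 = 1"
        using g_\<theta>[of 1] by (simp add: ring_hom_one[OF \<theta>] ring_hom_one[OF f])
    next
      fix q q'
      show "g (q + q') = g q + g q'"
      proof (rule g_eq)
        obtain s r where s: "s \<in> S" "\<theta> s * q = \<theta> r"
          using frac by blast
        obtain t r' where t: "t \<in> S" "\<theta> t * (\<theta> s * q') = \<theta> r'"
          using frac by blast
        have ts: "t * s \<in> S" and q: "\<theta> (t * s) * q = \<theta> (t * r)" and q': "\<theta> (t * s) * q' = \<theta> r'"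
          using s t by (simp_all add: closed ring_hom_mult[OF \<theta>] mult.assoc)
        have "f (t * s) * g q = f (t * r)" "f (t * s) * g q' = f r'"
          using G_frac[OF g ts] q q' by blast+
        with ts q q' show "G (q + q') (g q + g q')"
          unfolding G_def
          by (intro bexI[of _ "t * s"] exI[of _ "t * r + r'"])
            (simp_all add: distrib_left ring_hom_add[OF \<theta>] ring_hom_add[OF f])
      qed
      show "g (q * q') = g q * g q'"
      proof (rule g_eq)
        obtain s r where s: "s \<in> S" "\<theta> s * q' = \<theta> r"
          using frac by blast
        obtain z where z: "z * \<theta> s = 1"
          using \<theta>_unit[OF s(1)] by (auto simp: is_unit_elem_def)
        \<comment> \<open>Move the denominator of the right factor past the left factor.\<close>
        obtain t c where t: "t \<in> S" "\<theta> t * (q * z) = \<theta> c"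
          using frac by blast
        have q: "\<theta> t * q = \<theta> (c * s)"
          using mult_cancel_inverse[OF t(2) z] by (simp add: ring_hom_mult[OF \<theta>])
        have "\<theta> t * (q * q') = \<theta> (c * r)"
          by (simp add: q s(2) ring_hom_mult[OF \<theta>] mult.assoc flip: mult.assoc[of "\<theta> t"])
        moreover have "f t * (g q * g q') = f (c * r)"
          using G_frac[OF g t(1) q] G_frac[OF g s]
          by (simp add: ring_hom_mult[OF f] mult.assoc flip: mult.assoc[of "f t"])
        ultimately show "G (q * q') (g q * g q')"
          unfolding G_def using t(1) by blast
      qed
    qed
  qed
qed


section \<open>Homomorphisms out of polynomial rings\<close>

lemma ring_hom_mconst: "is_ring_hom mconst"
  by (rule is_ring_homI) (simp_all add: mconst_def single_add mult_single)

lemma single_eq_mconst_mult: "Poly_Mapping.single m c = mconst c * Poly_Mapping.single m 1"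
  by (simp add: mconst_def mult_single)

lemma mpoly_homs_eq:
  fixes f g :: "('c::ring_1, 'n) mpoly \<Rightarrow> 'a::{ring, monoid_mult}"
  assumes f: "is_ring_hom f" and g: "is_ring_hom g"
    and mconst: "\<And>c. f (mconst c) = g (mconst c)" and mvar: "\<And>i. f (mvar i) = g (mvar i)"
  shows "f p = g p"
proof -
  have mult: "f (x * y) = g (x * y)" if "f x = g x" "f y = g y" for x y
    using that by (simp add: ring_hom_mult[OF f] ring_hom_mult[OF g])
  have one: "f 1 = g 1"
    by (simp add: ring_hom_one[OF f] ring_hom_one[OF g])
  have var_power: "f (Poly_Mapping.single (Poly_Mapping.single i k) 1) =
      g (Poly_Mapping.single (Poly_Mapping.single i k) 1)" for i k
  proof (induction k)
    case (Suc k)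
    have "Poly_Mapping.single (Poly_Mapping.single i (Suc k)) (1::'c) =
        mvar i * Poly_Mapping.single (Poly_Mapping.single i k) 1"
      by (simp add: mvar_def mult_single flip: single_add)
    with Suc show ?case
      by (simp only: mult mvar)
  qed (simp add: one)
  have "f (Poly_Mapping.single m 1) = g (Poly_Mapping.single m 1)" for m
  proof (induction m rule: poly_mapping_single_induct)
    case (add i k m)
    have "Poly_Mapping.single (Poly_Mapping.single i k + m) (1::'c) =
        Poly_Mapping.single (Poly_Mapping.single i k) 1 * Poly_Mapping.single m 1"
      by (simp add: mult_single)
    with add show ?case
      by (simp only: mult var_power)
  qed (simp add: one)
  then have "f (Poly_Mapping.single m c) = g (Poly_Mapping.single m c)" for m c
    by (subst (1 2) single_eq_mconst_mult) (simp only: mult mconst)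
  then show ?thesis
    by (rule ring_homs_eq_on_singles[OF f g])
qed

lemma mpoly_hom_exists:
  fixes \<phi> :: "'c::ring_1 \<Rightarrow> 'a::comm_ring_1" and v :: "'n::finite \<Rightarrow> 'a"
  assumes \<phi>: "is_ring_hom \<phi>"
  obtains F where "is_ring_hom F" "\<And>c. F (mconst c) = \<phi> c" "\<And>i. F (mvar i) = v i"
proof
  let ?\<gamma> = "\<lambda>m. \<Prod>i\<in>UNIV. v i ^ Poly_Mapping.lookup m i"
  let ?F = "monoid_alg_eval \<phi> ?\<gamma>"
  show "is_ring_hom ?F"
    by (rule monoid_alg_eval_hom[OF \<phi>])
      (simp_all add: lookup_add power_add prod.distrib mult.commute)
  show "?F (mconst c) = \<phi> c" for c
    by (simp add: mconst_def monoid_alg_eval_single[OF \<phi>])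
  show "?F (mvar i) = v i" for i
  proof -
    have "?\<gamma> (Poly_Mapping.single i 1) = (\<Prod>j\<in>{i}. v j ^ Poly_Mapping.lookup (Poly_Mapping.single i 1) j)"
      by (rule prod.mono_neutral_right) (auto simp: lookup_single)
    then show ?thesis
      by (simp add: mvar_def monoid_alg_eval_single[OF \<phi>] ring_hom_one[OF \<phi>])
  qed
qed

text \<open>
  Monomials are central even over a noncommutative coefficient ring, so a change of coefficients is
  an instance of the universal property.
\<close>

lemma mpoly_coefficient_hom_exists:
  fixes g :: "'b::ring_1 \<Rightarrow> 'c::ring_1"
  assumes g: "is_ring_hom g"
  obtains G :: "('b, 'n) mpoly \<Rightarrow> ('c, 'n) mpoly" where
    "is_ring_hom G" "\<And>b. G (mconst b) = mconst (g b)" "\<And>i. G (mvar i) = mvar i"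
proof
  let ?\<phi> = "\<lambda>b. mconst (g b) :: ('c, 'n) mpoly"
  let ?G = "monoid_alg_eval ?\<phi> (\<lambda>m. Poly_Mapping.single m 1)"
  have \<phi>: "is_ring_hom ?\<phi>"
    by (rule ring_hom_comp[OF ring_hom_mconst g])
  show "is_ring_hom ?G"
    by (rule monoid_alg_eval_hom[OF \<phi>]) (simp_all add: mconst_def mult_single)
  show "?G (mconst b) = mconst (g b)" for b
    by (simp add: mconst_def[of b] monoid_alg_eval_single[OF \<phi>])
  show "?G (mvar i) = mvar i" for i
    by (simp add: mvar_def monoid_alg_eval_single[OF \<phi>] ring_hom_one[OF \<phi>])
qed


section \<open>The symmetric group action on the localized Weyl algebra\<close>

lemma perm_inverse: "inverse p * p = 1" "p * inverse p = 1"
  for p :: "'n perm"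
  by (auto intro!: perm_eqI simp: apply_times apply_inverse bij_is_inj bij_is_surj surj_f_inv_f)

lemma is_sym_actionI:
  assumes hom: "\<And>p. is_ring_hom (\<sigma> p)" and const: "\<And>p c. \<sigma> p (\<kappa> c) = \<kappa> c"
    and one: "\<And>x. \<sigma> 1 x = x" and mult: "\<And>p q x. \<sigma> (p * q) x = \<sigma> p (\<sigma> q x)"
  shows "is_sym_action \<kappa> \<sigma>"
proof -
  have "bij (\<sigma> p)" for p
    by (rule o_bij[of "\<sigma> (inverse p)"]) (simp_all add: fun_eq_iff perm_inverse one flip: mult)
  then show ?thesis
    using assms by (auto simp: is_sym_action_def is_alg_iso_def fun_eq_iff)
qed

lemma sym_action_hom: "is_sym_action \<kappa> \<sigma> \<Longrightarrow> is_ring_hom (\<sigma> p)"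
  and sym_action_const: "is_sym_action \<kappa> \<sigma> \<Longrightarrow> \<sigma> p (\<kappa> c) = \<kappa> c"
  and sym_action_one: "is_sym_action \<kappa> \<sigma> \<Longrightarrow> \<sigma> 1 x = x"
  and sym_action_mult: "is_sym_action \<kappa> \<sigma> \<Longrightarrow> \<sigma> (p * q) x = \<sigma> p (\<sigma> q x)"
  by (auto simp: is_sym_action_def is_alg_iso_def fun_eq_iff)

lemma ring_hom_abs_weyl: "is_ring_hom abs_weyl"
  by (rule is_ring_homI) (simp_all add: plus_weyl.abs_eq times_weyl.abs_eq one_weyl.abs_eq)

lemma w_const_eq: "w_const c = abs_weyl (fconst c)"
  and w_X_eq: "w_X j = abs_weyl (fgen (WX j))"
  and w_D_eq: "w_D j = abs_weyl (fgen (WD j))"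
  by (simp_all add: w_const.abs_eq w_X.abs_eq w_D.abs_eq)

lemma abs_weyl_cases: obtains a where "w = abs_weyl a"
  by (induction w rule: weyl.abs_induct) blast

lemma weyl_relation:
  assumes "x - y \<in> weyl_rels"
  shows "abs_weyl x = abs_weyl y"
  using assms by (simp add: weyl.abs_eq_iff ideal_cong_def ideal_gen.gen)

lemma weyl_relations:
  fixes i j :: 'n
  shows weyl_XX: "w_X i * w_X j = w_X j * (w_X i :: ('k::comm_ring_1, 'n) weyl)"
    and weyl_DD: "w_D i * w_D j = w_D j * (w_D i :: ('k, 'n) weyl)"
    and weyl_DX: "w_D i * w_X j = (if i = j then 1 else 0) + w_X j * (w_D i :: ('k, 'n) weyl)"
proof -
  let ?X = "\<lambda>j. fgen (WX j) :: ('n weyl_gen, 'k) free_alg" and ?D = "\<lambda>j. fgen (WD j)"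
  have "abs_weyl (?X i * ?X j) = abs_weyl (?X j * ?X i)"
       "abs_weyl (?D i * ?D j) = abs_weyl (?D j * ?D i)"
       "abs_weyl (?D i * ?X j) = abs_weyl ((if i = j then 1 else 0) + ?X j * ?D i)"
    by (rule weyl_relation; unfold weyl_rels_def Let_def; blast)+
  then show "w_X i * w_X j = w_X j * (w_X i :: ('k, 'n) weyl)"
    "w_D i * w_D j = w_D j * (w_D i :: ('k, 'n) weyl)"
    "w_D i * w_X j = (if i = j then 1 else 0) + w_X j * (w_D i :: ('k, 'n) weyl)"
    by (simp_all add: w_X_eq w_D_eq ring_hom_simps[OF ring_hom_abs_weyl] split: if_splits)
qed

lemma ring_hom_w_const: "is_ring_hom w_const"
  unfolding w_const_eq by (rule ring_hom_comp[OF ring_hom_abs_weyl ring_hom_fconst])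

lemma w_const_central: "w * w_const c = w_const c * w"
  by (rule abs_weyl_cases[of w])
    (simp add: w_const_eq fconst_central flip: ring_hom_mult[OF ring_hom_abs_weyl])

lemma weyl_homs_eq:
  assumes f: "is_ring_hom f" and g: "is_ring_hom g"
    and "\<And>c. f (w_const c) = g (w_const c)"
    and "\<And>j. f (w_X j) = g (w_X j)" "\<And>j. f (w_D j) = g (w_D j)"
  shows "f w = g w"
proof -
  have "f (abs_weyl a) = g (abs_weyl a)" for a
  proof (induction a rule: free_alg_induct)
    case (gen x)
    then show ?case
      using assms(4,5) by (cases x) (simp_all add: w_X_eq w_D_eq)
  qed (use assms(3) in \<open>simp_all add: w_const_eq ring_hom_simps[OF ring_hom_abs_weyl]
        ring_hom_simps[OF f] ring_hom_simps[OF g]\<close>)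
  then show ?thesis
    by (metis abs_weyl_cases)
qed

lemma weyl_hom_exists:
  fixes \<kappa> :: "'k::comm_ring_1 \<Rightarrow> 'a::{ring, monoid_mult}" and X D :: "'n \<Rightarrow> 'a"
  assumes \<kappa>: "is_ring_hom \<kappa>" and central: "\<And>c a. a * \<kappa> c = \<kappa> c * a"
    and XX: "\<And>i j. X i * X j = X j * X i" and DD: "\<And>i j. D i * D j = D j * D i"
    and DX: "\<And>i j. D i * X j = (if i = j then 1 else 0) + X j * D i"
  obtains F where "is_ring_hom F" "\<And>c. F (w_const c) = \<kappa> c"
    "\<And>j. F (w_X j) = X j" "\<And>j. F (w_D j) = D j"
proof -
  obtain E where E: "is_ring_hom E" "\<And>c. E (fconst c) = \<kappa> c"
    and E_gen: "\<And>g. E (fgen g) = (case g of WX j \<Rightarrow> X j | WD j \<Rightarrow> D j)"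
    by (rule free_alg_hom_exists[OF \<kappa> central,
          of "\<lambda>g. case g of WX j \<Rightarrow> X j | WD j \<Rightarrow> D j"]) blast
  note simps = ring_hom_simps[OF E(1)]
  have "E r = 0" if "r \<in> weyl_rels" for r
    using that by (auto simp: weyl_rels_def Let_def simps E_gen XX DD DX if_distrib[of E])
  then have kernel: "E a = E b" if "abs_weyl a = abs_weyl b" for a b
    using ring_hom_ideal_gen[OF E(1), of weyl_rels "a - b"] that
    by (simp add: weyl.abs_eq_iff ideal_cong_def simps)
  define F where "F w = E (SOME a. abs_weyl a = w)" for w
  have F: "F (abs_weyl a) = E a" for a
    unfolding F_def by (rule kernel) (rule someI[of _ a], rule refl)
  show thesis
  proof (rule that[of F])
    show "is_ring_hom F"
    proof (rule is_ring_homI)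
      fix v w :: "('k, 'n) weyl"
      obtain a b where "v = abs_weyl a" "w = abs_weyl b"
        by (metis abs_weyl_cases)
      then show "F (v + w) = F v + F w" "F (v * w) = F v * F w"
        by (simp_all add: F simps flip: ring_hom_add[OF ring_hom_abs_weyl] ring_hom_mult[OF ring_hom_abs_weyl])
    next
      show "F 1 = 1"
        by (simp add: F simps flip: ring_hom_one[OF ring_hom_abs_weyl])
    qed
  qed (simp_all add: w_const_eq w_X_eq w_D_eq F E E_gen)
qed

lemma weyl_action_exists: "\<exists>\<rho>. is_weyl_action (\<rho> :: 'n perm \<Rightarrow> ('k::comm_ring_1, 'n) weyl \<Rightarrow> ('k, 'n) weyl)"
proof -
  have "\<exists>F :: ('k, 'n) weyl \<Rightarrow> ('k, 'n) weyl. is_ring_hom F \<and> (\<forall>c. F (w_const c) = w_const c) \<and>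
      (\<forall>j. F (w_X j) = w_X (Perm.apply p j)) \<and> (\<forall>j. F (w_D j) = w_D (Perm.apply p j))"
    for p :: "'n perm"
  proof -
    have "(Perm.apply p i = Perm.apply p j) = (i = j)" for i j
      by (rule apply_inj)
    then have DX: "w_D (Perm.apply p i) * w_X (Perm.apply p j) =
        (if i = j then 1 else 0) + w_X (Perm.apply p j) * (w_D (Perm.apply p i) :: ('k, 'n) weyl)" for i j
      by (simp add: weyl_DX)
    show ?thesis
      by (rule weyl_hom_exists[OF ring_hom_w_const w_const_central weyl_XX weyl_DD DX]) blast
  qed
  then obtain \<rho> :: "'n perm \<Rightarrow> ('k, 'n) weyl \<Rightarrow> ('k, 'n) weyl" where
    \<rho>: "\<And>p. is_ring_hom (\<rho> p)" "\<And>p c. \<rho> p (w_const c) = w_const c"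
      "\<And>p j. \<rho> p (w_X j) = w_X (Perm.apply p j)" "\<And>p j. \<rho> p (w_D j) = w_D (Perm.apply p j)"
    by metis
  have "is_sym_action w_const \<rho>"
  proof (rule is_sym_actionI)
    show "\<rho> 1 w = w" for w
      by (rule weyl_homs_eq) (simp_all add: \<rho> is_ring_hom_def[of "\<lambda>x. x"])
    show "\<rho> (p * q) w = \<rho> p (\<rho> q w)" for p q w
      by (rule weyl_homs_eq) (simp_all add: \<rho> apply_times ring_hom_comp)
  qed (simp_all add: \<rho>)
  with \<rho> show ?thesis
    by (auto simp: is_weyl_action_def)
qed

lemma weyl_action_unique:
  assumes "is_weyl_action \<rho>" "is_weyl_action \<rho>'"
  shows "\<rho> = \<rho>'"
proof (intro ext)
  fix p w
  show "\<rho> p w = \<rho>' p w"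
    using assms unfolding is_weyl_action_def
    by (elim conjE) (rule weyl_homs_eq; simp add: sym_action_hom sym_action_const)
qed

lemma T_W_generators:
  fixes j k :: "'n::linorder"
  shows "w_X j \<in> (T_W :: ('k::comm_ring_1, 'n) weyl set)"
    and "j < k \<Longrightarrow> w_X j * w_D j - w_X k * w_D k + w_const (of_int l) \<in> (T_W :: ('k, 'n) weyl set)"
  unfolding T_W_def by (rule mult_gen_base; blast)+

text \<open>
  A permutation may reverse \<open>j < k\<close>; the generator \<open>X\<^sup>jD\<^sub>j - X\<^sup>kD\<^sub>k + l\<close> is then sent to the negative
  of a generator, which is still invertible.
\<close>

lemma weyl_action_inverts_T_W:
  fixes \<theta> :: "('k::comm_ring_1, 'n::linorder) weyl \<Rightarrow> 'b::{ring, monoid_mult}"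
  assumes loc: "is_localization T_W \<theta>" and \<rho>: "is_weyl_action \<rho>" and "t \<in> T_W"
  shows "is_unit_elem (\<theta> (\<rho> p t))"
proof (rule unit_mult_gen[where f = "\<lambda>w. \<theta> (\<rho> p w)"])
  have \<theta>: "is_ring_hom \<theta>" and unit: "\<And>t. t \<in> T_W \<Longrightarrow> is_unit_elem (\<theta> t)"
    using loc by (auto simp: is_localization_def)
  have act: "is_sym_action w_const \<rho>"
    and \<rho>_gen: "\<And>j. \<rho> p (w_X j) = w_X (Perm.apply p j)" "\<And>j. \<rho> p (w_D j) = w_D (Perm.apply p j)"
    using \<rho> by (auto simp: is_weyl_action_def)
  note hom = sym_action_hom[OF act, of p]
  show "is_ring_hom (\<lambda>w. \<theta> (\<rho> p w))"
    by (rule ring_hom_comp[OF \<theta> hom])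
  show "t \<in> mult_gen ({w_X j * w_D j - w_X k * w_D k + w_const (of_int l) | j k l. j < k} \<union> range w_X)"
    using \<open>t \<in> T_W\<close> by (simp add: T_W_def)
  let ?H = "\<lambda>j k l. w_X j * w_D j - w_X k * w_D k + w_const (of_int l) :: ('k, 'n) weyl"
  fix s assume "s \<in> {?H j k l | j k l. j < k} \<union> range w_X"
  then consider j k l where "j < k" "s = ?H j k l" | j where "s = w_X j"
    by blast
  then show "is_unit_elem (\<theta> (\<rho> p s))"
  proof cases
    case (1 j k l)
    let ?j = "Perm.apply p j" and ?k = "Perm.apply p k"
    have eq: "\<rho> p s = ?H ?j ?k l"
      by (simp add: 1 ring_hom_simps[OF hom] \<rho>_gen sym_action_const[OF act])
    have "?j \<noteq> ?k"
      using \<open>j < k\<close> by (simp add: apply_inj)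
    then consider "?j < ?k" | "?k < ?j"
      by force
    then show ?thesis
    proof cases
      case 2
      have "\<theta> (\<rho> p s) = - \<theta> (?H ?k ?j (- l))"
        by (simp add: eq ring_hom_simps[OF \<theta>] ring_hom_uminus[OF ring_hom_w_const])
      then show ?thesis
        using unit_uminus[OF unit[OF T_W_generators(2)[OF 2, of "- l"]]] by simp
    qed (simp add: eq unit T_W_generators)
  qed (simp add: \<rho>_gen unit T_W_generators)
qed

lemma localization_mpoly_homs_eq:
  assumes "is_localization S \<theta>" "is_ring_hom f" "is_ring_hom g"
    and "\<And>w. f (mconst (\<theta> w)) = g (mconst (\<theta> w))"
  shows "f (mconst b) = g (mconst b)"
  by (rule localization_homs_eq[OF assms(1)]) (simp_all add: assms ring_hom_comp ring_hom_mconst)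

lemma extended_action_exists:
  fixes \<theta> :: "('k::comm_ring_1, 'n::linorder) weyl \<Rightarrow> 'b::ring_1"
  assumes loc: "is_localization T_W \<theta>" and \<rho>: "is_weyl_action \<rho>"
  shows "\<exists>\<sigma>. is_extended_action \<theta> \<rho> \<sigma>"
proof -
  have \<theta>: "is_ring_hom \<theta>"
    using loc by (auto simp: is_localization_def)
  have act: "is_sym_action w_const \<rho>"
    using \<rho> by (auto simp: is_weyl_action_def)
  have "\<exists>g. is_ring_hom g \<and> (\<forall>w. g (\<theta> w) = \<theta> (\<rho> p w))" for p
    by (rule localization_hom_exists[OF loc _ _ ring_hom_comp[OF \<theta> sym_action_hom[OF act]]
          weyl_action_inverts_T_W[OF loc \<rho>]])
      (auto simp: T_W_def mult_gen.one mult_gen_closed)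
  then have "\<exists>G :: ('b, 'n) mpoly \<Rightarrow> ('b, 'n) mpoly. is_ring_hom G \<and>
      (\<forall>w. G (mconst (\<theta> w)) = mconst (\<theta> (\<rho> p w))) \<and> (\<forall>i. G (mvar i) = mvar i)" for p
    by (metis mpoly_coefficient_hom_exists)
  then obtain \<sigma> :: "'n perm \<Rightarrow> ('b, 'n) mpoly \<Rightarrow> ('b, 'n) mpoly" where
    \<sigma>: "\<And>p. is_ring_hom (\<sigma> p)" "\<And>p w. \<sigma> p (mconst (\<theta> w)) = mconst (\<theta> (\<rho> p w))"
      "\<And>p i. \<sigma> p (mvar i) = mvar i"
    by metis
  have eqI: "f q = g q" if "is_ring_hom f" "is_ring_hom g"
    "\<And>w. f (mconst (\<theta> w)) = g (mconst (\<theta> w))" "\<And>i. f (mvar i) = g (mvar i)"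
    for f g :: "('b, 'n) mpoly \<Rightarrow> ('b, 'n) mpoly" and q
    by (rule mpoly_homs_eq[OF that(1,2) localization_mpoly_homs_eq[OF loc that(1-3)] that(4)])
  have "is_sym_action (\<lambda>c. mconst (\<theta> (w_const c))) \<sigma>"
  proof (rule is_sym_actionI)
    show "\<sigma> 1 q = q" for q
      by (rule eqI) (simp_all add: \<sigma> sym_action_one[OF act] is_ring_hom_def[of "\<lambda>x. x"])
    show "\<sigma> (p * p') q = \<sigma> p (\<sigma> p' q)" for p p' q
      by (rule eqI) (simp_all add: \<sigma> sym_action_mult[OF act] ring_hom_comp)
  qed (simp_all add: \<sigma> sym_action_const[OF act])
  with \<sigma> show ?thesis
    by (auto simp: is_extended_action_def)
qed

lemma extended_action_unique:
  fixes \<theta> :: "('k::comm_ring_1, 'n::linorder) weyl \<Rightarrow> 'b::ring_1"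
  assumes loc: "is_localization T_W \<theta>"
    and \<sigma>: "is_extended_action \<theta> \<rho> \<sigma>" and \<sigma>': "is_extended_action \<theta> \<rho> \<sigma>'"
  shows "\<sigma> = \<sigma>'"
proof (intro ext)
  fix p q
  have hom: "is_ring_hom (\<sigma> p)" "is_ring_hom (\<sigma>' p)"
    using \<sigma> \<sigma>' by (auto simp: is_extended_action_def intro: sym_action_hom)
  show "\<sigma> p q = \<sigma>' p q"
    using \<sigma> \<sigma>' unfolding is_extended_action_def
    by (elim conjE) (rule mpoly_homs_eq[OF hom localization_mpoly_homs_eq[OF loc hom]]; simp)
qed


section \<open>Gradients of elementary symmetric polynomials\<close>

lemma ring_hom_prod:
  fixes f :: "'a::comm_ring_1 \<Rightarrow> 'b::comm_ring_1"
  assumes "is_ring_hom f"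
  shows "f (prod g A) = (\<Prod>a\<in>A. f (g a))"
  by (induction A rule: infinite_finite_induct)
    (simp_all add: ring_hom_one[OF assms] ring_hom_mult[OF assms])

text \<open>Summing over a set that contains the support makes the definition visibly additive.\<close>

lemma mpderiv_superset:
  assumes "finite A" "Poly_Mapping.keys p \<subseteq> A"
  shows "mpderiv j p = (\<Sum>m\<in>A. Poly_Mapping.single (m - Poly_Mapping.single j 1)
          (of_nat (Poly_Mapping.lookup m j) * Poly_Mapping.lookup p m))"
  unfolding mpderiv_def
  by (rule sum.mono_neutral_left) (use assms in \<open>auto simp: in_keys_iff\<close>)

lemma mpderiv_add:
  fixes p q :: "('r::ring_1, 'n) mpoly"
  shows "mpderiv j (p + q) = mpderiv j p + mpderiv j q"
proof -
  let ?A = "Poly_Mapping.keys p \<union> Poly_Mapping.keys q"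
  have "mpderiv j r = (\<Sum>m\<in>?A. Poly_Mapping.single (m - Poly_Mapping.single j 1)
          (of_nat (Poly_Mapping.lookup m j) * Poly_Mapping.lookup r m))"
    if "Poly_Mapping.keys r \<subseteq> ?A" for r :: "('r, 'n) mpoly"
    by (rule mpderiv_superset[OF _ that]) simp
  then show ?thesis
    using keys_add[of p q]
    by (simp add: lookup_add distrib_left single_add sum.distrib)
qed

lemma mpderiv_sum: "mpderiv j (sum f A) = (\<Sum>a\<in>A. mpderiv j (f a))"
  by (induction A rule: infinite_finite_induct) (simp_all add: mpderiv_add, simp_all add: mpderiv_def)

lemma prod_mvar_eq_single:
  assumes "finite S"
  shows "(\<Prod>i\<in>S. mvar i :: ('r::comm_ring_1, 'n) mpoly) =
    Poly_Mapping.single (\<Sum>i\<in>S. Poly_Mapping.single i 1) 1"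
  using assms by induction (simp_all add: mvar_def mult_single)

lemma mpderiv_prod_mvar:
  assumes "finite S"
  shows "mpderiv j (\<Prod>i\<in>S. mvar i) =
    (if j \<in> S then \<Prod>i\<in>S - {j}. mvar i else (0 :: ('r::comm_ring_1, 'n) mpoly))"
proof -
  let ?m = "\<lambda>S. \<Sum>i\<in>S. Poly_Mapping.single i (1::nat)"
  have lookup: "Poly_Mapping.lookup (?m S) j = (if j \<in> S then 1 else 0)"
    using assms by (simp add: lookup_sum lookup_single when_def)
  have deriv: "mpderiv j (Poly_Mapping.single (?m S) (1::'r)) =
      Poly_Mapping.single (?m S - Poly_Mapping.single j 1) (of_nat (if j \<in> S then 1 else 0))"
    by (subst mpderiv_superset[of "{?m S}"]) (auto simp: lookup simp del: One_nat_def)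
  show ?thesis
  proof (cases "j \<in> S")
    case True
    have "?m S - Poly_Mapping.single j 1 = ?m (S - {j})"
      using assms True by (simp add: sum.remove)
    then show ?thesis
      using True assms by (simp add: prod_mvar_eq_single deriv del: One_nat_def)
  qed (use assms in \<open>simp add: prod_mvar_eq_single deriv del: One_nat_def\<close>)
qed

lemma mpderiv_elem_sym:
  "mpderiv j (elem_sym k :: ('r::comm_ring_1, 'n::finite) mpoly) =
     (\<Sum>S | card S = k \<and> j \<in> S. \<Prod>i\<in>S - {j}. mvar i)"
proof -
  have "mpderiv j (elem_sym k :: ('r, 'n) mpoly) =
      (\<Sum>S | card S = k. if j \<in> S then \<Prod>i\<in>S - {j}. mvar i else 0)"
    unfolding elem_sym_def by (simp add: mpderiv_sum mpderiv_prod_mvar)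
  also have "\<dots> = (\<Sum>S | card S = k \<and> j \<in> S. \<Prod>i\<in>S - {j}. mvar i)"
    by (rule sum.mono_neutral_cong_right) auto
  finally show ?thesis .
qed

text \<open>
  Since \<open>\<partial>\<^sub>j e\<^sub>k\<close> is the elementary symmetric polynomial of degree \<open>k - 1\<close> in the variables other than
  \<open>h\<^sub>j\<close>, the combination below is the expansion of \<open>\<Prod>\<^bsub>l \<noteq> j\<^esub> (t - h\<^sub>l)\<close> at \<open>t = h\<^sub>i\<close>. As \<open>i\<close> varies, this
  is a matrix that diagonalizes the Jacobian matrix of \<open>e\<^sub>1, \<dots>, e\<^sub>n\<close>.
\<close>

lemma elem_sym_gradient_combination:
  "(\<Sum>k\<in>{1..CARD('n)}. (-1) ^ (k - 1) * mvar i ^ (CARD('n) - k) * mpderiv j (elem_sym k)) =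
     (\<Prod>l\<in>UNIV - {j}. hdiff_poly i l :: ('r::comm_ring_1, 'n::finite) mpoly)"
proof -
  let ?N = "CARD('n)"
  let ?g = "\<lambda>S. (-1) ^ (card S - 1) * mvar i ^ (?N - card S) * (\<Prod>l\<in>S - {j}. mvar l) :: ('r, 'n) mpoly"
  have "(\<Sum>k\<in>{1..?N}. (-1) ^ (k - 1) * mvar i ^ (?N - k) * mpderiv j (elem_sym k)) =
      (\<Sum>k\<in>{1..?N}. \<Sum>S\<in>{S\<in>{S. j \<in> S}. card S = k}. ?g S)"
    by (simp add: mpderiv_elem_sym sum_distrib_left conj_commute)
  also have "\<dots> = (\<Sum>S | j \<in> S. ?g S)"
  proof (rule sum.group)
    show "card ` {S. j \<in> S} \<subseteq> {1..?N}"
      by (auto simp: Suc_le_eq card_gt_0_iff card_mono)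
  qed simp_all
  also have "\<dots> = (\<Sum>X\<in>Pow (UNIV - {j}). (\<Prod>l\<in>X. - mvar l) * (\<Prod>l\<in>UNIV - {j} - X. mvar i))"
  proof (rule sum.reindex_bij_witness[of _ "insert j" "\<lambda>S. S - {j}"])
    fix S assume "S \<in> {S. j \<in> S}"
    then have j: "j \<in> S" and card: "card (S - {j}) = card S - 1" "card (- S) = ?N - card S"
      by (simp_all add: Compl_eq_Diff_UNIV card_Diff_subset)
    have "UNIV - {j} - (S - {j}) = - S"
      using j by auto
    then show "(\<Prod>l\<in>S - {j}. - mvar l) * (\<Prod>l\<in>UNIV - {j} - (S - {j}). mvar i) = ?g S"
      by (simp add: card prod_uminus mult.assoc mult.commute mult.left_commute)
  qed auto
  also have "\<dots> = (\<Prod>l\<in>UNIV - {j}. - mvar l + mvar i)"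
    by (rule prod_add[symmetric]) simp
  finally show ?thesis
    by (simp add: hdiff_poly_def)
qed

lemma hdiff_in_hdenoms: "i \<noteq> j \<Longrightarrow> hdiff_poly i j \<in> (hdenoms :: ('k::idom, 'n::linorder) mpoly set)"
  using hdiff_poly_in_hdenoms[of i j 0] by simp

lemma prod_in_hdenoms: "(\<And>a. a \<in> A \<Longrightarrow> f a \<in> hdenoms) \<Longrightarrow> prod f A \<in> hdenoms"
  by (induction A rule: infinite_finite_induct) (simp_all add: hdenoms_mult)

text \<open>
  A consequence of the diagonalization: the Jacobian matrix acts injectively on columns over any
  ring in which the differences \<open>h\<^sub>i - h\<^sub>l\<close> become invertible.
\<close>

lemma elem_sym_gradients_independent:
  fixes f :: "('k::idom, 'n::{finite, linorder}) mpoly \<Rightarrow> 'q::{ring, monoid_mult}"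
  assumes f: "is_ring_hom f" and unit: "\<And>d. d \<in> hdenoms \<Longrightarrow> is_unit_elem (f d)"
    and zero: "\<And>k. k \<in> {1..CARD('n)} \<Longrightarrow> (\<Sum>j\<in>UNIV. f (mpderiv j (elem_sym k)) * Y j) = 0"
  shows "Y i = 0"
proof -
  let ?c = "\<lambda>k. (-1) ^ (k - 1) * mvar i ^ (CARD('n) - k) :: ('k, 'n) mpoly"
  let ?V = "\<lambda>j. \<Prod>l\<in>UNIV - {j}. hdiff_poly i l :: ('k, 'n) mpoly"
  have "f (?V i) * Y i = (\<Sum>j\<in>UNIV. f (?V j) * Y j)"
  proof -
    have "f (?V j) * Y j = 0" if "j \<noteq> i" for j
    proof -
      have "?V j = 0"
        using that by (auto simp: hdiff_poly_def)
      then show ?thesis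
        by (simp only: ring_hom_zero[OF f] mult_zero_left)
    qed
    then have "(\<Sum>j\<in>UNIV. f (?V j) * Y j) = (\<Sum>j\<in>{i}. f (?V j) * Y j)"
      by (intro sum.mono_neutral_right) auto
    then show ?thesis by simp
  qed
  also have "\<dots> = (\<Sum>j\<in>UNIV. \<Sum>k\<in>{1..CARD('n)}. f (?c k) * (f (mpderiv j (elem_sym k)) * Y j))"
    by (simp only: ring_hom_sum[OF f] ring_hom_mult[OF f] sum_distrib_right mult.assoc
        flip: elem_sym_gradient_combination)
  also have "\<dots> = (\<Sum>k\<in>{1..CARD('n)}. f (?c k) * (\<Sum>j\<in>UNIV. f (mpderiv j (elem_sym k)) * Y j))"
    by (subst sum.swap) (simp add: sum_distrib_left)
  also have "\<dots> = f (?V i) * 0"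
    by (simp add: zero)
  finally show ?thesis
    by (rule unit_cancel_left[rotated]) (rule unit, auto intro!: prod_in_hdenoms hdiff_in_hdenoms)
qed

lemma pos_surj:
  assumes "k \<in> {1..CARD('n::{finite, linorder})}"
  shows "\<exists>i::'n. pos i = k"
proof -
  have "inj (pos :: 'n \<Rightarrow> nat)"
  proof (rule linorder_injI)
    fix i j :: 'n assume "i < j"
    then have "{..i} \<subset> {..j}" by auto
    then show "pos i \<noteq> pos j"
      unfolding pos_def using psubset_card_mono[of "{..j}" "{..i}"] by simp
  qed
  moreover have "range (pos :: 'n \<Rightarrow> nat) \<subseteq> {1..CARD('n)}"
    by (auto simp: pos_def Suc_le_eq card_gt_0_iff card_mono)
  ultimately have "range (pos :: 'n \<Rightarrow> nat) = {1..CARD('n)}"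
    by (intro card_subset_eq) (simp_all add: card_image)
  with assms show ?thesis
    by (metis rangeE)
qed

lemma pos_Suc_lessThan:
  fixes i i' :: "'n::{finite, linorder}"
  assumes "pos i' = pos i + 1"
  shows "{..<i'} = insert i {..<i}"
proof -
  have "i < i'"
  proof (rule ccontr)
    assume "\<not> i < i'"
    then have "card {..i'} \<le> card {..i}"
      by (intro card_mono) auto
    with assms show False
      by (simp add: pos_def)
  qed
  then have "{..i} \<subseteq> {..<i'}"
    by auto
  moreover have "{..i'} = insert i' {..<i'}"
    by auto
  then have "card {..i'} = card {..<i'} + 1"
    by simp
  ultimately have "{..i} = {..<i'}"
    using assms by (intro card_subset_eq) (simp_all add: pos_def)
  then show ?thesis
    using ivl_disj_un_singleton(2)[of i] by auto
qed


section \<open>Permutations of the variables\<close>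

text \<open>
  The substitution exists by \<open>mpoly_hom_exists\<close>, and only its values on constants and variables matter.
\<close>

definition mpoly_perm :: "'n perm \<Rightarrow> ('k::comm_ring_1, 'n::finite) mpoly \<Rightarrow> ('k, 'n) mpoly" where
  "mpoly_perm p = (SOME F. is_ring_hom F \<and> (\<forall>c. F (mconst c) = mconst c) \<and>
     (\<forall>i. F (mvar i) = mvar (Perm.apply p i)))"

lemma mpoly_perm:
  fixes p :: "'n::finite perm"
  shows ring_hom_mpoly_perm: "is_ring_hom (mpoly_perm p :: ('k::comm_ring_1, 'n) mpoly \<Rightarrow> _)"
    and mpoly_perm_mconst: "mpoly_perm p (mconst c) = (mconst c :: ('k, 'n) mpoly)"
    and mpoly_perm_mvar: "mpoly_perm p (mvar i) = (mvar (Perm.apply p i) :: ('k, 'n) mpoly)"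
proof -
  have "\<exists>F. is_ring_hom F \<and> (\<forall>c. F (mconst c) = (mconst c :: ('k, 'n) mpoly)) \<and>
     (\<forall>i. F (mvar i) = mvar (Perm.apply p i))"
    by (rule mpoly_hom_exists[OF ring_hom_mconst, of "\<lambda>i. mvar (Perm.apply p i)"]) blast
  from someI_ex[OF this] show "is_ring_hom (mpoly_perm p :: ('k, 'n) mpoly \<Rightarrow> _)"
    "mpoly_perm p (mconst c) = (mconst c :: ('k, 'n) mpoly)"
    "mpoly_perm p (mvar i) = (mvar (Perm.apply p i) :: ('k, 'n) mpoly)"
    unfolding mpoly_perm_def by blast+
qed

lemmas mpoly_perm_simps =
  ring_hom_simps[OF ring_hom_mpoly_perm] ring_hom_prod[OF ring_hom_mpoly_perm] mpoly_perm_mvar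

lemma mpoly_perm_hdiff: "mpoly_perm p (hdiff_poly i j) = hdiff_poly (Perm.apply p i) (Perm.apply p j)"
  by (simp add: hdiff_poly_def mpoly_perm_simps)

lemma mpoly_perm_psi':
  "mpoly_perm p (psi' j) = (\<Prod>k\<in>{..<j}. hdiff_poly (Perm.apply p j) (Perm.apply p k))"
  by (simp add: psi'_def mpoly_perm_simps mpoly_perm_hdiff)

lemma inv_perm [simp]: "inv (Perm.apply p) (Perm.apply p i) = i" "Perm.apply p (inv (Perm.apply p) i) = i"
  by (simp_all add: bij_is_inj bij_is_surj surj_f_inv_f)

lemma image_inv_perm [simp]:
  "inv (Perm.apply p) ` Perm.apply p ` S = S" "Perm.apply p ` inv (Perm.apply p) ` S = S"
  by (simp_all add: image_image)

lemma inj_on_perm [simp]: "inj_on (Perm.apply p) S"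
  by (meson bij_apply bij_is_inj inj_on_subset subset_UNIV)

lemma inj_on_inv_perm [simp]: "inj_on (inv (Perm.apply p)) S"
  by (metis apply_inverse inj_on_perm)

lemma mpoly_perm_elem_sym: "mpoly_perm p (elem_sym k) = (elem_sym k :: ('k::comm_ring_1, 'n::finite) mpoly)"
proof -
  have "mpoly_perm p (elem_sym k :: ('k, 'n) mpoly) = (\<Sum>S | card S = k. \<Prod>i\<in>S. mvar (Perm.apply p i))"
    by (simp add: elem_sym_def mpoly_perm_simps)
  also have "\<dots> = (\<Sum>S | card S = k. \<Prod>i\<in>S. mvar i)"
    by (rule sum.reindex_bij_witness[of _ "image (inv (Perm.apply p))" "image (Perm.apply p)"])
      (auto simp: card_image prod.reindex)
  finally show ?thesis
    by (simp add: elem_sym_def)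
qed

lemma mpoly_perm_mpderiv_elem_sym:
  "mpoly_perm p (mpderiv j (elem_sym k)) =
     (mpderiv (Perm.apply p j) (elem_sym k) :: ('k::comm_ring_1, 'n::finite) mpoly)"
proof -
  have "mpoly_perm p (mpderiv j (elem_sym k) :: ('k, 'n) mpoly) =
      (\<Sum>S | card S = k \<and> j \<in> S. \<Prod>i\<in>S - {j}. mvar (Perm.apply p i))"
    by (simp add: mpderiv_elem_sym mpoly_perm_simps)
  also have "\<dots> = (\<Sum>S | card S = k \<and> Perm.apply p j \<in> S. \<Prod>i\<in>S - {Perm.apply p j}. mvar i)"
  proof (rule sum.reindex_bij_witness[of _ "image (inv (Perm.apply p))" "image (Perm.apply p)"])
    fix S assume "S \<in> {S. card S = k \<and> j \<in> S}"
    have "Perm.apply p ` S - {Perm.apply p j} = Perm.apply p ` (S - {j})"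
      by (auto simp: apply_inj)
    then show "(\<Prod>i\<in>Perm.apply p ` S - {Perm.apply p j}. mvar i) =
        (\<Prod>i\<in>S - {j}. mvar (Perm.apply p i) :: ('k, 'n) mpoly)"
      by (simp add: prod.reindex)
  next
    fix S assume "S \<in> {S. card S = k \<and> Perm.apply p j \<in> S}"
    then show "inv (Perm.apply p) ` S \<in> {S. card S = k \<and> j \<in> S}"
      by (auto simp: card_image image_iff intro!: bexI[of _ "Perm.apply p j"])
  qed (auto simp: card_image)
  finally show ?thesis
    by (simp add: mpderiv_elem_sym)
qed

lemma mpoly_perm_hdenoms:
  assumes "d \<in> hdenoms"
  shows "mpoly_perm p d \<in> (hdenoms :: ('k::idom, 'n::{finite, linorder}) mpoly set)"
  using assms unfolding hdenoms_def
proof induction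
  case one
  show ?case
    by (simp add: mpoly_perm_simps mult_gen.one)
next
  case (mult s t)
  then obtain i j k where s: "s = hdiff_poly i j + of_int k" and "i \<noteq> j"
    by blast
  have "mpoly_perm p (of_int k :: ('k, 'n) mpoly) = of_int k"
    using mpoly_perm_mconst[of p "of_int k :: 'k"] by (simp add: mconst_def)
  with \<open>i \<noteq> j\<close> have "mpoly_perm p s \<in> hdenoms"
    by (simp add: s mpoly_perm_simps mpoly_perm_hdiff hdiff_poly_in_hdenoms apply_inj)
  with mult.IH show ?case
    unfolding hdenoms_def by (simp add: mpoly_perm_simps mult_gen_closed)
qed


section \<open>The ring of h-deformed differential operators\<close>

lemma upoly_add: "upoly (p + q) = upoly p + upoly q"
  by transfer simp

lemma upoly_mult: "upoly (p * q) = upoly p * upoly q"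
  by transfer simp

lemma upoly_one: "upoly 1 = 1"
  by transfer (simp add: One_fract_def)

lemma ring_hom_upoly: "is_ring_hom upoly"
  by (rule is_ring_homI) (simp_all add: upoly_add upoly_mult upoly_one)

lemma ufrac_inverse: "q \<in> hdenoms \<Longrightarrow> ufrac 1 q * upoly q = 1"
  by (simp add: ufrac_mult_upoly ring_hom_one[OF ring_hom_upoly])

lemma ufrac_cases: obtains p q where "q \<in> hdenoms" "u = ufrac p q"
proof -
  have "\<exists>p q. q \<in> hdenoms \<and> u = ufrac p q"
    by transfer auto
  with that show ?thesis by blast
qed

lemma ring_hom_abs_hdiff: "is_ring_hom abs_hdiff"
  by (rule is_ring_homI) (simp_all add: plus_hdiff.abs_eq times_hdiff.abs_eq one_hdiff.abs_eq)

lemma hd_const_eq: "hd_const c = abs_hdiff (fconst c)"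
  and hd_x_eq: "hd_x j = abs_hdiff (fgen (HX j))"
  and hd_d_eq: "hd_d j = abs_hdiff (fgen (HD j))"
  by (simp_all add: hd_const.abs_eq hd_x.abs_eq hd_d.abs_eq)

lemma hdiff_relation:
  assumes "x - y \<in> hdiff_rels"
  shows "abs_hdiff x = abs_hdiff y"
  using assms by (simp add: hdiff.abs_eq_iff ideal_cong_def ideal_gen.gen)

lemma hdiff_induct [case_names scalar U x d add mult]:
  fixes P :: "('k::idom, 'n::{finite, linorder}) hdiff \<Rightarrow> bool"
  assumes "\<And>c. P (hd_const c)" "\<And>u. P (hd_U u)" "\<And>j. P (hd_x j)" "\<And>j. P (hd_d j)"
    and "\<And>y z. P y \<Longrightarrow> P z \<Longrightarrow> P (y + z)" "\<And>y z. P y \<Longrightarrow> P z \<Longrightarrow> P (y * z)"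
  shows "P y"
proof -
  have "P (abs_hdiff a)" for a
  proof (induction a rule: free_alg_induct)
    case (gen g)
    then show ?case
      using assms(2-4) by (cases g) (simp_all add: hd_U_def hd_x_eq hd_d_eq)
  qed (simp_all add: assms ring_hom_simps[OF ring_hom_abs_hdiff] flip: hd_const_eq)
  then show ?thesis
    by (induction y rule: hdiff.abs_induct) blast
qed

lemma hd_U_relations:
  fixes u v :: "('k::idom, 'n::{finite, linorder}) ubar"
  shows hd_U_add: "hd_U (u + v) = hd_U u + hd_U v"
    and hd_U_mult: "hd_U (u * v) = hd_U u * hd_U v"
    and hd_U_mconst: "hd_U (upoly (mconst c)) = (hd_const c :: ('k, 'n) hdiff)"
proof -
  let ?U = "\<lambda>u. fgen (HU u) :: ((('k, 'n) ubar, 'n) hdiff_gen, 'k) free_alg"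
  have "abs_hdiff (?U (u + v)) = abs_hdiff (?U u + ?U v)"
       "abs_hdiff (?U (u * v)) = abs_hdiff (?U u * ?U v)"
       "abs_hdiff (?U (upoly (mconst c))) = abs_hdiff (fconst c)"
    by (rule hdiff_relation; unfold hdiff_rels_def Let_def; blast)+
  then show "hd_U (u + v) = hd_U u + hd_U v" "hd_U (u * v) = hd_U u * hd_U v"
    "hd_U (upoly (mconst c)) = (hd_const c :: ('k, 'n) hdiff)"
    by (simp_all add: hd_U_def hd_const_eq ring_hom_simps[OF ring_hom_abs_hdiff])
qed

lemma ring_hom_hd_U: "is_ring_hom hd_U"
proof (rule is_ring_homI)
  have "hd_U (upoly (mconst 1)) = abs_hdiff (fconst 1)"
    by (simp add: hd_U_mconst hd_const_eq)
  then show "hd_U 1 = 1"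
    by (simp add: ring_hom_one[OF ring_hom_mconst] ring_hom_one[OF ring_hom_upoly]
        ring_hom_one[OF ring_hom_fconst] ring_hom_one[OF ring_hom_abs_hdiff])
qed (simp_all add: hd_U_add hd_U_mult)

abbreviation hd_poly :: "('k, 'n) mpoly \<Rightarrow> ('k::idom, 'n::{finite, linorder}) hdiff" where
  "hd_poly f \<equiv> hd_U (upoly f)"

lemma ring_hom_hd_poly: "is_ring_hom hd_poly"
  by (rule ring_hom_comp[OF ring_hom_hd_U ring_hom_upoly])

lemmas hd_poly_simps = ring_hom_simps[OF ring_hom_hd_poly]

lemma hd_ufrac_inverse:
  assumes "q \<in> hdenoms"
  shows "hd_U (ufrac 1 q) * hd_poly q = 1" "hd_poly q * hd_U (ufrac 1 q) = 1"
  using ufrac_inverse[OF assms]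
  by (simp_all add: ring_hom_one[OF ring_hom_hd_U] mult.commute[of "upoly q"] flip: hd_U_mult)

lemma hd_poly_unit: "q \<in> hdenoms \<Longrightarrow> is_unit_elem (hd_poly q)"
  unfolding is_unit_elem_def using hd_ufrac_inverse by blast

lemma hd_const_central: "y * hd_const c = hd_const c * y"
proof -
  have "abs_hdiff a * hd_const c = hd_const c * abs_hdiff a" for a
    by (simp add: hd_const_eq fconst_central flip: ring_hom_mult[OF ring_hom_abs_hdiff])
  then show ?thesis
    by (induction y rule: hdiff.abs_induct) blast
qed

lemma hd_weight_relations:
  fixes i j :: "'n::{finite, linorder}"
  shows hd_h_x: "hd_h i * hd_x j = hd_x j * (hd_poly (mvar i + (if i = j then 1 else 0)) :: ('k::idom, 'n) hdiff)"
    and hd_h_d: "hd_h i * hd_d j = hd_d j * (hd_poly (mvar i - (if i = j then 1 else 0)) :: ('k, 'n) hdiff)"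
proof -
  let ?U = "\<lambda>f. fgen (HU (upoly f)) :: ((('k, 'n) ubar, 'n) hdiff_gen, 'k) free_alg"
  let ?\<delta> = "if i = j then 1 else 0"
  have "abs_hdiff (?U (mvar i) * fgen (HX j)) = abs_hdiff (fgen (HX j) * ?U (mvar i + ?\<delta>))"
       "abs_hdiff (?U (mvar i) * fgen (HD j)) = abs_hdiff (fgen (HD j) * ?U (mvar i - ?\<delta>))"
    by (rule hdiff_relation; unfold hdiff_rels_def Let_def; blast)+
  then show "hd_h i * hd_x j = hd_x j * (hd_poly (mvar i + ?\<delta>) :: ('k, 'n) hdiff)"
      "hd_h i * hd_d j = hd_d j * (hd_poly (mvar i - ?\<delta>) :: ('k, 'n) hdiff)"
    by (simp_all only: hd_U_def hd_x_eq hd_d_eq ring_hom_mult[OF ring_hom_abs_hdiff])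
qed

lemma hd_poly_of_int_central: "y * hd_poly (of_int k) = hd_poly (of_int k) * y"
proof -
  have "of_int k = mconst (of_int k)"
    by (simp add: mconst_def)
  then show ?thesis
    by (metis hd_U_mconst hd_const_central)
qed

lemma hd_hdiff_relations:
  fixes a i j :: "'n::{finite, linorder}"
  defines "\<delta> \<equiv> (if j = a then 1 else 0) - (if i = a then 1 else 0)"
  shows hd_x_hdiff: "hd_x a * hd_poly (hdiff_poly i j + of_int k) =
      (hd_poly (hdiff_poly i j + of_int (k + \<delta>)) * hd_x a :: ('k::idom, 'n) hdiff)"
    and hd_hdiff_d: "hd_poly (hdiff_poly i j + of_int k) * hd_d a =
      (hd_d a * hd_poly (hdiff_poly i j + of_int (k + \<delta>)) :: ('k, 'n) hdiff)"
proof -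
  have h: "hd_h i * hd_x a = hd_x a * hd_h i + (if i = a then hd_x a else (0 :: ('k, 'n) hdiff))"
      "hd_h i * hd_d a = hd_d a * hd_h i - (if i = a then hd_d a else (0 :: ('k, 'n) hdiff))" for i
    by (simp_all add: hd_h_x hd_h_d hd_poly_simps distrib_left right_diff_distrib)
  note distribs = hdiff_poly_def hd_poly_simps distrib_left distrib_right
    left_diff_distrib right_diff_distrib
  show "hd_x a * hd_poly (hdiff_poly i j + of_int k) =
      (hd_poly (hdiff_poly i j + of_int (k + \<delta>)) * hd_x a :: ('k, 'n) hdiff)"
    using hd_poly_of_int_central[of "hd_x a :: ('k, 'n) hdiff" k]
    by (auto simp: \<delta>_def distribs h)
  show "hd_poly (hdiff_poly i j + of_int k) * hd_d a =
      (hd_d a * hd_poly (hdiff_poly i j + of_int (k + \<delta>)) :: ('k, 'n) hdiff)"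
    using hd_poly_of_int_central[of "hd_d a :: ('k, 'n) hdiff" k]
    by (auto simp: \<delta>_def distribs h)
qed

text \<open>
  Moving past \<open>x\<^sup>a\<close> only shifts the integers \<open>k\<close> in the factors \<open>h\<^sub>i - h\<^sub>j + k\<close>, and the denominator set
  contains all these shifts. This is what lets a right factor of \<open>x\<^sup>a\<close> be absorbed into \<open>\<partial>\<^sub>a\<close>.
\<close>

lemma hd_x_move_denominator:
  fixes q :: "('k::idom, 'n::{finite, linorder}) mpoly"
  assumes "q \<in> hdenoms"
  shows "\<exists>q'\<in>hdenoms. hd_x a * hd_poly q = hd_poly q' * hd_x a"
  using assms unfolding hdenoms_def
proof induction
  case one
  show ?case
    by (rule bexI[of _ 1]) (simp_all add: hd_poly_simps mult_gen.one)
next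
  case (mult s t)
  then obtain t' where t': "t' \<in> hdenoms" "hd_x a * hd_poly t = hd_poly t' * hd_x a"
    unfolding hdenoms_def by blast
  obtain i j k where s: "s = hdiff_poly i j + of_int k" and "i \<noteq> j"
    using mult by blast
  define s' :: "('k, 'n) mpoly" where
    "s' = hdiff_poly i j + of_int (k + ((if j = a then 1 else 0) - (if i = a then 1 else 0)))"
  have s': "s' \<in> hdenoms"
    using \<open>i \<noteq> j\<close> unfolding s'_def by (rule hdiff_poly_in_hdenoms)
  have xs: "hd_x a * hd_poly s = hd_poly s' * hd_x a"
    unfolding s s'_def by (rule hd_x_hdiff)
  have "hd_x a * hd_poly (s * t) = (hd_x a * hd_poly s) * hd_poly t"
    by (simp add: hd_poly_simps mult.assoc)
  also have "\<dots> = hd_poly (s' * t') * hd_x a"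
    by (simp add: xs t' hd_poly_simps mult.assoc)
  finally show ?case
    using hdenoms_mult[OF s' t'(1)] unfolding hdenoms_def by blast
qed

lemma psi'_in_hdenoms: "psi' j \<in> (hdenoms :: ('k::idom, 'n::{finite, linorder}) mpoly set)"
  unfolding psi'_def by (rule prod_in_hdenoms) (auto intro: hdiff_in_hdenoms)


section \<open>Lifts of permutations to the localization\<close>

text \<open>
  The three facts about the automorphism attached to a permutation that are used; they do not refer
  to the Weyl algebra any more.
\<close>

locale permutation_lift =
  fixes \<theta> :: "('k::idom, 'n::{finite, linorder}) hdiff \<Rightarrow> 'q::{ring, monoid_mult}"
    and p :: "'n perm" and \<tau> :: "'q \<Rightarrow> 'q"
  assumes loc: "is_localization S_x \<theta>"
    and hom: "is_ring_hom \<tau>"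
    and const: "\<tau> (\<theta> (hd_const c)) = \<theta> (hd_const c)"
    and h: "\<tau> (\<theta> (hd_h j)) = \<theta> (hd_h (Perm.apply p j))"
    and x_psi': "\<tau> (\<theta> (hd_x j * hd_poly (psi' j))) =
      \<theta> (hd_x (Perm.apply p j) * hd_poly (psi' (Perm.apply p j)))"
    and c: "k \<in> {1..CARD('n)} \<Longrightarrow> \<tau> (\<theta> (hd_c k)) = \<theta> (hd_c k)"
begin

lemma hom_loc: "is_ring_hom \<theta>"
  and x_unit: "is_unit_elem (\<theta> (hd_x j))"
proof -
  have "hd_x j \<in> S_x"
    unfolding S_x_def by (rule mult_gen_base) simp
  then show "is_ring_hom \<theta>" "is_unit_elem (\<theta> (hd_x j))"
    using loc by (auto simp: is_localization_def)
qed

lemmas loc_simps = ring_hom_simps[OF hom_loc]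

lemma denominator_unit: "q \<in> hdenoms \<Longrightarrow> is_unit_elem (\<theta> (hd_poly q))"
  by (rule ring_hom_unit[OF hom_loc hd_poly_unit])

lemma poly: "\<tau> (\<theta> (hd_poly f)) = \<theta> (hd_poly (mpoly_perm p f))"
  by (rule mpoly_homs_eq[OF ring_hom_comp[OF hom ring_hom_comp[OF hom_loc ring_hom_hd_poly]]
        ring_hom_comp[OF ring_hom_comp[OF hom_loc ring_hom_hd_poly] ring_hom_mpoly_perm]])
    (simp_all add: mpoly_perm_mconst mpoly_perm_mvar hd_U_mconst const h)

lemma ufrac:
  assumes "q \<in> hdenoms"
  shows "\<tau> (\<theta> (hd_U (ufrac f q))) = \<theta> (hd_U (ufrac (mpoly_perm p f) (mpoly_perm p q)))"
proof (rule unit_cancel_right)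
  have q: "mpoly_perm p q \<in> hdenoms"
    by (rule mpoly_perm_hdenoms[OF assms])
  then show "is_unit_elem (\<theta> (hd_poly (mpoly_perm p q)))"
    by (rule denominator_unit)
  have "\<tau> (\<theta> (hd_U (ufrac f q))) * \<theta> (hd_poly (mpoly_perm p q)) = \<tau> (\<theta> (hd_U (ufrac f q * upoly q)))"
    by (simp add: hd_U_mult ring_hom_mult[OF hom] loc_simps poly)
  also have "\<dots> = \<theta> (hd_U (ufrac (mpoly_perm p f) (mpoly_perm p q) * upoly (mpoly_perm p q)))"
    by (simp add: ufrac_mult_upoly[OF assms] ufrac_mult_upoly[OF q] poly)
  finally show "\<tau> (\<theta> (hd_U (ufrac f q))) * \<theta> (hd_poly (mpoly_perm p q)) =
      \<theta> (hd_U (ufrac (mpoly_perm p f) (mpoly_perm p q))) * \<theta> (hd_poly (mpoly_perm p q))"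
    by (simp add: hd_U_mult loc_simps)
qed

text \<open>
  The image of \<open>x\<^sup>j\<close> is known after multiplication by the unit \<open>\<tau>(\<psi>'\<^sub>j)\<close>, so a candidate only has to be
  checked after that multiplication.
\<close>

lemma xI:
  assumes "y * hd_poly (mpoly_perm p (psi' j)) = hd_x (Perm.apply p j) * hd_poly (psi' (Perm.apply p j))"
  shows "\<tau> (\<theta> (hd_x j)) = \<theta> y"
proof (rule unit_cancel_right)
  let ?u = "\<theta> (hd_poly (mpoly_perm p (psi' j)))"
  show "is_unit_elem ?u"
    by (intro denominator_unit mpoly_perm_hdenoms psi'_in_hdenoms)
  show "\<tau> (\<theta> (hd_x j)) * ?u = \<theta> y * ?u"
    using x_psi'[of j] by (simp add: ring_hom_mult[OF hom] loc_simps poly flip: assms)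
qed

text \<open>
  Applied to \<open>c\<^sub>k\<close>, the invariance under \<open>\<tau>\<close> says that \<open>\<Gamma>\<^sub>j\<close> and the pulled back \<open>\<tau>(\<Gamma>\<^bsub>p\<^sup>-\<^sup>1 j\<^esub>)\<close> solve the
  same linear system, whose matrix is the Jacobian matrix of the elementary symmetric polynomials.
\<close>

lemma Gamma: "\<tau> (\<theta> (hd_Gamma j)) = \<theta> (hd_Gamma (Perm.apply p j))"
proof -
  let ?q = "inv (Perm.apply p)"
  let ?e = "\<lambda>k j. \<theta> (hd_poly (mpderiv j (elem_sym k)))"
  define Y where "Y j = \<tau> (\<theta> (hd_Gamma (?q j))) - \<theta> (hd_Gamma j)" for j
  have "Y i = 0" for i
  proof (rule elem_sym_gradients_independent[OF ring_hom_comp[OF hom_loc ring_hom_hd_poly]])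
    fix k assume k: "k \<in> {1..CARD('n)}"
    have "\<tau> (\<theta> (hd_c k)) = (\<Sum>j\<in>UNIV. ?e k (Perm.apply p j) * \<tau> (\<theta> (hd_Gamma j))) - \<theta> (hd_poly (elem_sym k))"
      by (simp add: hd_c_def loc_simps ring_hom_simps[OF hom] poly mpoly_perm_elem_sym mpoly_perm_mpderiv_elem_sym)
    also have "(\<Sum>j\<in>UNIV. ?e k (Perm.apply p j) * \<tau> (\<theta> (hd_Gamma j))) =
        (\<Sum>j\<in>UNIV. ?e k j * \<tau> (\<theta> (hd_Gamma (?q j))))"
      by (rule sum.reindex_bij_witness[of _ ?q "Perm.apply p"]) simp_all
    finally have "(\<Sum>j\<in>UNIV. ?e k j * \<tau> (\<theta> (hd_Gamma (?q j)))) = (\<Sum>j\<in>UNIV. ?e k j * \<theta> (hd_Gamma j))"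
      using c[OF k] by (simp add: hd_c_def loc_simps)
    then show "(\<Sum>j\<in>UNIV. ?e k j * Y j) = 0"
      by (simp add: Y_def right_diff_distrib sum_subtractf)
  qed (rule denominator_unit)
  from this[of "Perm.apply p j"] show ?thesis
    by (simp add: Y_def)
qed

text \<open>
  Likewise \<open>\<tau>(\<partial>\<^sub>j)\<close> is the quotient of \<open>\<tau>(\<Gamma>\<^sub>j)\<close> by the unit \<open>\<tau>(x\<^sup>j)\<close>. The quotient is taken in the
  localization, but the condition on the candidate lives in the ring of differential operators.
\<close>

lemma dI:
  assumes x: "\<tau> (\<theta> (hd_x j)) = \<theta> z" and "y * z = hd_d (Perm.apply p j) * hd_x (Perm.apply p j)"
  shows "\<tau> (\<theta> (hd_d j)) = \<theta> y"
proof (rule unit_cancel_right)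
  show "is_unit_elem (\<tau> (\<theta> (hd_x j)))"
    by (rule ring_hom_unit[OF hom x_unit])
  have "\<tau> (\<theta> (hd_d j)) * \<tau> (\<theta> (hd_x j)) = \<tau> (\<theta> (hd_Gamma j))"
    by (simp add: hd_Gamma_def loc_simps ring_hom_mult[OF hom])
  also have "\<dots> = \<theta> (y * z)"
    using Gamma[of j] by (simp add: hd_Gamma_def assms(2))
  finally show "\<tau> (\<theta> (hd_d j)) * \<tau> (\<theta> (hd_x j)) = \<theta> y * \<tau> (\<theta> (hd_x j))"
    by (simp add: x loc_simps)
qed

text \<open>
  For \<open>\<partial>\<^sub>j\<close> the quotient of \<open>\<Gamma>\<^bsub>p(j)\<^esub> = \<partial>\<^bsub>p(j)\<^esub> x\<^bsup>p(j)\<^esup>\<close> by \<open>\<tau>(x\<^sup>j)\<close> exists without inverting any \<open>x\<close>: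
  \<open>\<tau>(x\<^sup>j)\<close> is \<open>x\<^bsup>p(j)\<^esup>\<close> times a unit of the localized polynomial ring, and the unit can be moved to
  the left of \<open>x\<^bsup>p(j)\<^esup>\<close>.
\<close>

lemma preserves_range: "\<tau> (\<theta> y) \<in> range \<theta>"
proof (induction y rule: hdiff_induct)
  case (scalar c)
  show ?case
    by (simp add: const)
next
  case (U u)
  obtain f q where "q \<in> hdenoms" "u = ufrac f q"
    by (rule ufrac_cases)
  then show ?case
    by (simp add: ufrac)
next
  case (x j)
  let ?r = "mpoly_perm p (psi' j)"
  have r: "?r \<in> hdenoms"
    by (intro mpoly_perm_hdenoms psi'_in_hdenoms)
  have "\<tau> (\<theta> (hd_x j)) =
      \<theta> (hd_x (Perm.apply p j) * hd_poly (psi' (Perm.apply p j)) * hd_U (ufrac 1 ?r))"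
    by (rule xI) (simp add: mult.assoc hd_ufrac_inverse[OF r])
  then show ?case
    by simp
next
  case (d j)
  let ?r = "mpoly_perm p (psi' j)"
  let ?j = "Perm.apply p j"
  have r: "?r \<in> hdenoms"
    by (intro mpoly_perm_hdenoms psi'_in_hdenoms)
  have x: "\<tau> (\<theta> (hd_x j)) = \<theta> (hd_x ?j * hd_poly (psi' ?j) * hd_U (ufrac 1 ?r))"
    by (rule xI) (simp add: mult.assoc hd_ufrac_inverse[OF r])
  obtain s :: "('k, 'n) mpoly" where s: "s \<in> hdenoms" "hd_x ?j * hd_poly (psi' ?j) = hd_poly s * hd_x ?j"
    using hd_x_move_denominator[OF psi'_in_hdenoms] by blast
  obtain t :: "('k, 'n) mpoly" where t: "hd_x ?j * hd_poly ?r = hd_poly t * hd_x ?j"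
    using hd_x_move_denominator[OF r] by blast
  have "\<tau> (\<theta> (hd_d j)) = \<theta> (hd_d ?j * hd_poly t * hd_U (ufrac 1 s))"
  proof (rule dI[OF x])
    have "hd_d ?j * hd_poly t * hd_U (ufrac 1 s) * (hd_x ?j * hd_poly (psi' ?j) * hd_U (ufrac 1 ?r)) =
        hd_d ?j * hd_poly t * (hd_U (ufrac 1 s) * hd_poly s) * hd_x ?j * hd_U (ufrac 1 ?r)"
      by (simp only: s mult.assoc)
    also have "\<dots> = hd_d ?j * (hd_poly t * hd_x ?j) * hd_U (ufrac 1 ?r)"
      by (simp add: hd_ufrac_inverse[OF s(1)] mult.assoc)
    also have "\<dots> = hd_d ?j * hd_x ?j"
      by (simp add: hd_ufrac_inverse[OF r] mult.assoc flip: t)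
    finally show "hd_d ?j * hd_poly t * hd_U (ufrac 1 s) *
        (hd_x ?j * hd_poly (psi' ?j) * hd_U (ufrac 1 ?r)) = hd_d ?j * hd_x ?j" .
  qed
  then show ?case
    by simp
next
  case (add y z)
  then obtain y' z' where "\<tau> (\<theta> y) = \<theta> y'" "\<tau> (\<theta> z) = \<theta> z'"
    by blast
  then have "\<tau> (\<theta> (y + z)) = \<theta> (y' + z')"
    by (simp add: loc_simps ring_hom_add[OF hom])
  then show ?case
    by simp
next
  case (mult y z)
  then obtain y' z' where "\<tau> (\<theta> y) = \<theta> y'" "\<tau> (\<theta> z) = \<theta> z'"
    by blast
  then have "\<tau> (\<theta> (y * z)) = \<theta> (y' * z')"
    by (simp add: loc_simps ring_hom_mult[OF hom])
  then show ?case
    by simp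
qed

end

locale transposition_lift = permutation_lift \<theta> "Perm.swap i i'" \<tau>
  for \<theta> :: "('k::idom, 'n::{finite, linorder}) hdiff \<Rightarrow> 'q::{ring, monoid_mult}"
    and i i' :: 'n and \<tau> :: "'q \<Rightarrow> 'q" +
  assumes adjacent: "pos i' = pos i + 1"
begin

abbreviation "s \<equiv> Perm.swap i i'"

lemma lessThan_i': "{..<i'} = insert i {..<i}"
  by (rule pos_Suc_lessThan[OF adjacent])

lemma less_i': "k < i' \<longleftrightarrow> k = i \<or> k < i"
  using lessThan_i' by (auto simp: set_eq_iff)

lemma i_neq_i': "i \<noteq> i'"
  using less_i'[of i] by auto

lemma hdiff_i_i': "hdiff_poly i i' \<in> hdenoms"
  by (rule hdiff_in_hdenoms[OF i_neq_i'])

lemma apply_s [simp]: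
  "Perm.apply s i = i'" "Perm.apply s i' = i" "k \<noteq> i \<Longrightarrow> k \<noteq> i' \<Longrightarrow> Perm.apply s k = k"
  by simp_all

lemma apply_s_less: "k < i \<Longrightarrow> Perm.apply s k = k"
  using less_i'[of k] by (intro apply_s(3)) auto

lemma perm_psi'_i: "mpoly_perm s (psi' i) = (\<Prod>k\<in>{..<i}. hdiff_poly i' k :: ('k, 'n) mpoly)"
  unfolding mpoly_perm_psi' by (rule prod.cong) (simp_all add: apply_s_less)

text \<open>
  By adjacency \<open>\<psi>'\<^bsub>i'\<^esub>\<close> has exactly one factor more than \<open>\<psi>'\<^sub>i\<close>, coming from \<open>k = i\<close>. The
  transposition turns the remaining factors of the one product into those of the other.
\<close>

lemma psi'_i': "psi' i' = hdiff_poly i' i * (mpoly_perm s (psi' i) :: ('k, 'n) mpoly)"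
  by (simp add: psi'_def[of i'] perm_psi'_i lessThan_i')

lemma perm_psi'_i': "mpoly_perm s (psi' i') = hdiff_poly i i' * (psi' i :: ('k, 'n) mpoly)"
proof -
  have "(\<Prod>k\<in>{..<i}. hdiff_poly i (Perm.apply s k)) = (psi' i :: ('k, 'n) mpoly)"
    unfolding psi'_def by (rule prod.cong) (simp_all add: apply_s_less)
  then show ?thesis
    by (simp add: mpoly_perm_psi' lessThan_i')
qed

text \<open>An index other than \<open>i, i'\<close> lies above both or below both, so its product is symmetric in them.\<close>

lemma perm_psi'_other:
  assumes "j \<noteq> i" "j \<noteq> i'"
  shows "mpoly_perm s (psi' j) = (psi' j :: ('k, 'n) mpoly)"
proof -
  have lt: "i < j \<longleftrightarrow> i' < j"
    using less_i'[of j] less_i'[of i] assms by (metis less_trans not_less_iff_gr_or_eq)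
  have stable: "Perm.apply s k < j" if "k < j" for k
    using lt that by (cases "k = i"; cases "k = i'") simp_all
  have involution: "Perm.apply s (Perm.apply s k) = k" for k
    by (cases "k = i"; cases "k = i'") simp_all
  have "(\<Prod>k\<in>{..<j}. hdiff_poly j (Perm.apply s k)) = (\<Prod>k\<in>{..<j}. hdiff_poly j k :: ('k, 'n) mpoly)"
    by (rule prod.reindex_bij_witness[of _ "Perm.apply s" "Perm.apply s"])
      (simp_all add: stable involution)
  then show ?thesis
    using assms by (simp add: mpoly_perm_psi') (simp add: psi'_def)
qed

lemma x_i: "\<tau> (\<theta> (hd_x i)) = \<theta> (- (hd_x i' * hd_hh i i'))"
proof (rule xI)
  have "hdiff_poly i' i = (- hdiff_poly i i' :: ('k, 'n) mpoly)"
    by (simp add: hdiff_poly_def)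
  then show "- (hd_x i' * hd_hh i i') * hd_poly (mpoly_perm s (psi' i)) =
      hd_x (Perm.apply s i) * (hd_poly (psi' (Perm.apply s i)) :: ('k, 'n) hdiff)"
    by (simp add: psi'_i' hd_poly_simps mult.assoc)
qed

lemma x_i': "\<tau> (\<theta> (hd_x i')) = \<theta> (hd_x i * hd_inv_hh i i')"
proof (rule xI)
  have "hd_x i * hd_inv_hh i i' * hd_poly (mpoly_perm s (psi' i')) =
      hd_x i * (hd_inv_hh i i' * hd_hh i i') * (hd_poly (psi' i) :: ('k, 'n) hdiff)"
    by (simp only: perm_psi'_i' hd_poly_simps mult.assoc)
  then show "hd_x i * hd_inv_hh i i' * hd_poly (mpoly_perm s (psi' i')) =
      hd_x (Perm.apply s i') * (hd_poly (psi' (Perm.apply s i')) :: ('k, 'n) hdiff)"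
    by (simp add: hd_ufrac_inverse[OF hdiff_i_i'])
qed

lemma x_other: "j \<noteq> i \<Longrightarrow> j \<noteq> i' \<Longrightarrow> \<tau> (\<theta> (hd_x j)) = \<theta> (hd_x j)"
  by (rule xI) (simp add: perm_psi'_other)

lemma d_i: "\<tau> (\<theta> (hd_d i)) = \<theta> (- (hd_inv_hh i i' * hd_d i'))"
proof (rule dI[OF x_i])
  have x: "hd_x i' * hd_hh i i' = (hd_poly (hdiff_poly i i' + 1) * hd_x i' :: ('k, 'n) hdiff)"
    using hd_x_hdiff[of i' i i' 0] i_neq_i' by simp
  have d: "hd_hh i i' * hd_d i' = (hd_d i' * hd_poly (hdiff_poly i i' + 1) :: ('k, 'n) hdiff)"
    using hd_hdiff_d[of i i' 0 i'] i_neq_i' by simp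
  have "- (hd_inv_hh i i' * hd_d i') * - (hd_x i' * hd_hh i i') =
      hd_inv_hh i i' * (hd_d i' * hd_poly (hdiff_poly i i' + 1)) * (hd_x i' :: ('k, 'n) hdiff)"
    by (simp add: x mult.assoc)
  also have "\<dots> = (hd_inv_hh i i' * hd_hh i i') * hd_d i' * hd_x i'"
    by (simp only: d[symmetric] mult.assoc)
  finally show "- (hd_inv_hh i i' * hd_d i') * - (hd_x i' * hd_hh i i') =
      hd_d (Perm.apply s i) * (hd_x (Perm.apply s i) :: ('k, 'n) hdiff)"
    by (simp add: hd_ufrac_inverse[OF hdiff_i_i'])
qed

lemma d_i': "\<tau> (\<theta> (hd_d i')) = \<theta> (hd_hh i i' * hd_d i)"
proof (rule dI[OF x_i'])
  have x: "hd_x i * hd_hh i i' = (hd_poly (hdiff_poly i i' - 1) * hd_x i :: ('k, 'n) hdiff)"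
    using hd_x_hdiff[of i i i' 0] i_neq_i' by simp
  have d: "hd_hh i i' * hd_d i = (hd_d i * hd_poly (hdiff_poly i i' - 1) :: ('k, 'n) hdiff)"
    using hd_hdiff_d[of i i' 0 i] i_neq_i' by simp
  have "hd_hh i i' * hd_d i * (hd_x i * hd_inv_hh i i') =
      hd_d i * (hd_poly (hdiff_poly i i' - 1) * hd_x i) * (hd_inv_hh i i' :: ('k, 'n) hdiff)"
    by (simp only: d mult.assoc)
  also have "\<dots> = hd_d i * hd_x i * (hd_hh i i' * hd_inv_hh i i')"
    by (simp only: x[symmetric] mult.assoc)
  finally show "hd_hh i i' * hd_d i * (hd_x i * hd_inv_hh i i') =
      hd_d (Perm.apply s i') * (hd_x (Perm.apply s i') :: ('k, 'n) hdiff)"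
    by (simp add: hd_ufrac_inverse[OF hdiff_i_i'])
qed

lemma d_other: "j \<noteq> i \<Longrightarrow> j \<noteq> i' \<Longrightarrow> \<tau> (\<theta> (hd_d j)) = \<theta> (hd_d j)"
  by (rule dI[OF x_other]) simp_all

end


section \<open>The transported action\<close>

theorem mainTheorem5:
  fixes \<theta>W :: "('k::{idom, ring_char_0}, 'n::{finite, linorder}) weyl \<Rightarrow> 'b::ring_1"
    and \<theta>D :: "('k, 'n) hdiff \<Rightarrow> 'q::{ring, monoid_mult}"
    and \<mu> :: "('b, 'n) mpoly \<Rightarrow> 'q"
  assumes loc_W: "is_localization T_W \<theta>W"
    and loc_D: "is_localization S_x \<theta>D"
    and mu_iso: "is_alg_iso (\<lambda>c. mconst (\<theta>W (w_const c))) (\<lambda>c. \<theta>D (hd_const c)) \<mu>"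
    and mu_X: "\<And>i. \<mu> (mconst (\<theta>W (w_X i))) = \<theta>D (hd_x i * hd_U (upoly (psi' i)))"
    and mu_H: "\<And>i. \<mu> (mconst (\<theta>W (w_H i))) = \<theta>D (hd_h i)"
    and mu_a: "\<And>i. \<mu> (mvar i) = \<theta>D (hd_c (pos i))"
  shows
    "(\<exists>!\<rho>. is_weyl_action (\<rho> :: 'n perm \<Rightarrow> ('k, 'n) weyl \<Rightarrow> ('k, 'n) weyl)) \<and>
     (\<forall>\<rho>. is_weyl_action \<rho> \<longrightarrow>
       (\<exists>!\<sigma>. is_extended_action \<theta>W \<rho> \<sigma>) \<and>
       (\<forall>\<sigma>. is_extended_action \<theta>W \<rho> \<sigma> \<longrightarrow>
         (let \<tau> = transport_action \<mu> \<sigma> in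
            is_sym_action (\<lambda>c. \<theta>D (hd_const c)) \<tau> \<and>
            (\<forall>p. \<tau> p ` range \<theta>D = range \<theta>D) \<and>
            (\<forall>i i'. pos i' = pos i + 1 \<longrightarrow>
              (let s = Perm.swap i i' in
                 \<tau> s (\<theta>D (hd_x i)) = \<theta>D (- (hd_x i' * hd_hh i i')) \<and>
                 \<tau> s (\<theta>D (hd_x i')) = \<theta>D (hd_x i * hd_inv_hh i i') \<and>
                 (\<forall>j. j \<noteq> i \<and> j \<noteq> i' \<longrightarrow> \<tau> s (\<theta>D (hd_x j)) = \<theta>D (hd_x j)) \<and>
                 \<tau> s (\<theta>D (hd_d i)) = \<theta>D (- (hd_inv_hh i i' * hd_d i')) \<and>
                 \<tau> s (\<theta>D (hd_d i')) = \<theta>D (hd_hh i i' * hd_d i) \<and>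
                 (\<forall>j. j \<noteq> i \<and> j \<noteq> i' \<longrightarrow> \<tau> s (\<theta>D (hd_d j)) = \<theta>D (hd_d j)) \<and>
                 (\<forall>j. \<tau> s (\<theta>D (hd_h j)) = \<theta>D (hd_h (Perm.apply s j))))))))"
proof (intro conjI allI impI)
  show "\<exists>!\<rho>. is_weyl_action (\<rho> :: 'n perm \<Rightarrow> ('k, 'n) weyl \<Rightarrow> ('k, 'n) weyl)"
    using weyl_action_exists weyl_action_unique by (rule ex_ex1I)
next
  fix \<rho> :: "'n perm \<Rightarrow> ('k, 'n) weyl \<Rightarrow> ('k, 'n) weyl"
  assume \<rho>: "is_weyl_action \<rho>"
  show "\<exists>!\<sigma>. is_extended_action \<theta>W \<rho> \<sigma>"
    using extended_action_exists[OF loc_W \<rho>] extended_action_unique[OF loc_W] by (rule ex_ex1I)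
  fix \<sigma>
  assume \<sigma>: "is_extended_action \<theta>W \<rho> \<sigma>"
  define \<tau> where "\<tau> = transport_action \<mu> \<sigma>"
  have act_W: "is_sym_action w_const \<rho>"
    and \<rho>_X: "\<And>p j. \<rho> p (w_X j) = w_X (Perm.apply p j)"
    and \<rho>_D: "\<And>p j. \<rho> p (w_D j) = w_D (Perm.apply p j)"
    using \<rho> by (auto simp: is_weyl_action_def)
  have act: "is_sym_action (\<lambda>c. mconst (\<theta>W (w_const c))) \<sigma>"
    and \<sigma>_mconst: "\<And>p w. \<sigma> p (mconst (\<theta>W w)) = mconst (\<theta>W (\<rho> p w))"
    and \<sigma>_mvar: "\<And>p i. \<sigma> p (mvar i) = mvar i"
    using \<sigma> by (auto simp: is_extended_action_def)
  have \<mu>: "is_ring_hom \<mu>" "bij \<mu>" and \<mu>_const: "\<And>c. \<mu> (mconst (\<theta>W (w_const c))) = \<theta>D (hd_const c)"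
    using mu_iso by (auto simp: is_alg_iso_def)
  have \<tau>_\<mu>: "\<tau> p (\<mu> z) = \<mu> (\<sigma> p z)" for p z
    using \<mu>(2) by (simp add: \<tau>_def transport_action_def bij_is_inj)
  have \<mu>_cases: "\<exists>z. y = \<mu> z" for y
    using \<mu>(2) by (metis bij_pointE)
  have act_\<tau>: "is_sym_action (\<lambda>c. \<theta>D (hd_const c)) \<tau>"
  proof (rule is_sym_actionI)
    fix p q :: "'n perm"
    have \<tau>_eq: "\<tau> p = (\<lambda>y. \<mu> (\<sigma> p (inv \<mu> y)))"
      by (simp add: \<tau>_def transport_action_def fun_eq_iff)
    show "is_ring_hom (\<tau> p)"
      unfolding \<tau>_eq
      by (intro ring_hom_comp[OF \<mu>(1)] ring_hom_comp[OF sym_action_hom[OF act]] ring_hom_inv \<mu>)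
    show "\<tau> p (\<theta>D (hd_const c)) = \<theta>D (hd_const c)" for c
      using \<tau>_\<mu>[of p "mconst (\<theta>W (w_const c))"] sym_action_const[OF act, of p c]
      by (simp add: \<mu>_const)
    show "\<tau> 1 y = y" "\<tau> (p * q) y = \<tau> p (\<tau> q y)" for y
      using \<mu>_cases[of y] by (auto simp: \<tau>_\<mu> sym_action_one[OF act] sym_action_mult[OF act])
  qed
  have lift: "permutation_lift \<theta>D p (\<tau> p)" for p
  proof
    show "is_localization S_x \<theta>D"
      by (rule loc_D)
    show "is_ring_hom (\<tau> p)" "\<tau> p (\<theta>D (hd_const c)) = \<theta>D (hd_const c)" for c
      using sym_action_hom[OF act_\<tau>] sym_action_const[OF act_\<tau>] by auto
    show "\<tau> p (\<theta>D (hd_h j)) = \<theta>D (hd_h (Perm.apply p j))" for j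
      by (simp add: \<tau>_\<mu> \<sigma>_mconst w_H_def ring_hom_mult[OF sym_action_hom[OF act_W]] \<rho>_X \<rho>_D
          flip: mu_H)
    show "\<tau> p (\<theta>D (hd_x j * hd_poly (psi' j))) =
        \<theta>D (hd_x (Perm.apply p j) * hd_poly (psi' (Perm.apply p j)))" for j
      by (simp add: \<tau>_\<mu> \<sigma>_mconst \<rho>_X flip: mu_X)
    show "\<tau> p (\<theta>D (hd_c k)) = \<theta>D (hd_c k)" if "k \<in> {1..CARD('n)}" for k
      using pos_surj[OF that] by (auto simp: \<tau>_\<mu> \<sigma>_mvar simp flip: mu_a)
  qed
  have subset: "\<tau> p ` range \<theta>D \<subseteq> range \<theta>D" for p
    using permutation_lift.preserves_range[OF lift] by auto
  have range: "\<tau> p ` range \<theta>D = range \<theta>D" for p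
  proof
    have "y = \<tau> p (\<tau> (inverse p) y)" for y
      by (simp add: perm_inverse sym_action_one[OF act_\<tau>] flip: sym_action_mult[OF act_\<tau>])
    then show "range \<theta>D \<subseteq> \<tau> p ` range \<theta>D"
      using subset[of "inverse p"] by blast
  qed (rule subset)
  have swap: "transposition_lift \<theta>D i i' (\<tau> (Perm.swap i i'))" if "pos i' = pos i + 1" for i i'
    using lift that by (simp add: transposition_lift_def transposition_lift_axioms_def)
  show "let \<tau> = transport_action \<mu> \<sigma> in
            is_sym_action (\<lambda>c. \<theta>D (hd_const c)) \<tau> \<and>
            (\<forall>p. \<tau> p ` range \<theta>D = range \<theta>D) \<and>
            (\<forall>i i'. pos i' = pos i + 1 \<longrightarrow>
              (let s = Perm.swap i i' in
                 \<tau> s (\<theta>D (hd_x i)) = \<theta>D (- (hd_x i' * hd_hh i i')) \<and>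
                 \<tau> s (\<theta>D (hd_x i')) = \<theta>D (hd_x i * hd_inv_hh i i') \<and>
                 (\<forall>j. j \<noteq> i \<and> j \<noteq> i' \<longrightarrow> \<tau> s (\<theta>D (hd_x j)) = \<theta>D (hd_x j)) \<and>
                 \<tau> s (\<theta>D (hd_d i)) = \<theta>D (- (hd_inv_hh i i' * hd_d i')) \<and>
                 \<tau> s (\<theta>D (hd_d i')) = \<theta>D (hd_hh i i' * hd_d i) \<and>
                 (\<forall>j. j \<noteq> i \<and> j \<noteq> i' \<longrightarrow> \<tau> s (\<theta>D (hd_d j)) = \<theta>D (hd_d j)) \<and>
                 (\<forall>j. \<tau> s (\<theta>D (hd_h j)) = \<theta>D (hd_h (Perm.apply s j)))))"
    unfolding Let_def \<tau>_def[symmetric]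
    by (intro conjI allI impI act_\<tau> range permutation_lift.h[OF lift]
        transposition_lift.x_i[OF swap] transposition_lift.x_i'[OF swap] transposition_lift.x_other[OF swap]
        transposition_lift.d_i[OF swap] transposition_lift.d_i'[OF swap] transposition_lift.d_other[OF swap];
      simp)
qed

end
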